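(* For a generic Gough-Stewart platform, the cubic surface $\Sigma$ is rational over $K=\mathbb{R}(\mathrm{SO}(3))$, i.e. it is birationally equivalent over $K$ to the affine plane $\mathbb{A}^2_K$.
   Context: A Gough-Stewart platform (its architecture) is given by vectors $A_1,\dots,A_6\in\mathbb{R}^3$ and $b_1,\dots,b_6\in\mathbb{R}^3$; frames are chosen so that $A_1=b_1=0$. "Generic" means: for all architectures in some nonempty Zariski open subset of the real parameter space of architectures. Let $K=\mathbb{R}(\mathrm{SO}(3))$ be the field of rational functions on $\mathrm{SO}(3)$ and let $R$ be the generic rotation matrix (its entries are the coordinate functions in $K$). The cross product over $K$ is defined by the usual formulas. Put $B_i=Rb_i$, $C_i=B_i-A_i$, $P=(x,y,z)^{\mathsf T}$, and let $\mathrm{Jac}$ be the $6\times6$ matrix whose $i$-th row is $\big((C_i+P)^{\mathsf T},(A_i\times(C_i+P))^{\mathsf T}\big)$. $\Sigma$ is the surface $\det(\mathrm{Jac})=0$ in affine 3-space over $K$ with coordinates $x,y,z$; its equation has degree 3 in $x,y,z$ for a generic platform. *)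

theory Defs
  imports
    "HOL-Analysis.Analysis"
    "HOL-Computational_Algebra.Polynomial"
    "HOL-Computational_Algebra.Fraction_Field"
    "HOL-Library.Poly_Mapping"
begin

section \<open>A rational parametrisation of \<open>SO(3)\<close>\<close>

text \<open>
  By the Euler--Rodrigues parametrisation by quaternions, any two rotations lie on a common
  rational curve in \<open>SO(3)\<close>. This is used below to show that the coordinate ring of
  \<open>SO(3)\<close> is an integral domain.
\<close>

definition quat_norm :: "'a::comm_ring_1 \<Rightarrow> 'a \<Rightarrow> 'a \<Rightarrow> 'a \<Rightarrow> 'a" where
  "quat_norm a b c d = a * a + b * b + c * c + d * d"

definition quat_mat :: "'a::comm_ring_1 \<Rightarrow> 'a \<Rightarrow> 'a \<Rightarrow> 'a \<Rightarrow> 'a^3^3" where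
  "quat_mat a b c d = vector
    [vector [a*a + b*b - c*c - d*d, 2 * (b*c - a*d), 2 * (b*d + a*c)],
     vector [2 * (b*c + a*d), a*a - b*b + c*c - d*d, 2 * (c*d - a*b)],
     vector [2 * (b*d - a*c), 2 * (c*d + a*b), a*a - b*b - c*c + d*d]]"

lemma rotation_matrix_quat_mat:
  fixes a b c d :: real
  assumes n: "quat_norm a b c d \<noteq> 0"
  shows "rotation_matrix (\<chi> i j. quat_mat a b c d $ i $ j / quat_norm a b c d)"
proof -
  let ?n = "quat_norm a b c d" and ?E = "quat_mat a b c d"
  have E: "(\<Sum>k\<in>UNIV. ?E $ k $ i * ?E $ k $ j) = (if i = j then ?n * ?n else 0)" for i j
  proof -
    have "\<forall>i j. (\<Sum>k\<in>UNIV. ?E $ k $ i * ?E $ k $ j) = (if i = j then ?n * ?n else 0)"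
      by (simp add: forall_3 sum_3 quat_mat_def quat_norm_def) (simp add: algebra_simps)
    then show ?thesis by blast
  qed
  have "(\<Sum>k\<in>UNIV. ?E $ k $ i / ?n * (?E $ k $ j / ?n)) = (if i = j then 1 else 0)" for i j
    using E[of i j] n by (simp add: sum_divide_distrib [symmetric] divide_simps)
  then have "orthogonal_matrix (\<chi> i j. ?E $ i $ j / ?n)"
    by (simp add: orthogonal_matrix vec_eq_iff matrix_matrix_mult_def transpose_def mat_def)
  moreover have "det ?E = ?n ^ 3"
    by (simp add: det_3 quat_mat_def quat_norm_def algebra_simps power3_eq_cube)
  then have "det (\<chi> i j. ?E $ i $ j / ?n) = 1"
    using n by (simp add: det_3 power3_eq_cube divide_simps)
  ultimately show ?thesis by (simp add: rotation_matrix_def)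
qed

lemma rotation_matrix_cofactors:
  fixes M :: "real^3^3"
  assumes "rotation_matrix M"
  shows "M$1$3 = M$2$1 * M$3$2 - M$3$1 * M$2$2" "M$2$3 = M$3$1 * M$1$2 - M$1$1 * M$3$2"
    "M$3$3 = M$1$1 * M$2$2 - M$2$1 * M$1$2"
    "M$1$1 = M$2$2 * M$3$3 - M$3$2 * M$2$3" "M$2$1 = M$3$2 * M$1$3 - M$1$2 * M$3$3"
    "M$3$1 = M$1$2 * M$2$3 - M$2$2 * M$1$3"
    "M$1$2 = M$2$3 * M$3$1 - M$3$3 * M$2$1" "M$2$2 = M$3$3 * M$1$1 - M$1$3 * M$3$1"
    "M$3$2 = M$1$3 * M$2$1 - M$2$3 * M$1$1"
  using cross_rotation_matrix[OF assms, of "axis 1 1" "axis 2 1"]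
    cross_rotation_matrix[OF assms, of "axis 2 1" "axis 3 1"]
    cross_rotation_matrix[OF assms, of "axis 3 1" "axis 1 1"]
  by (simp_all add: cross3_def vec_eq_iff forall_3 matrix_vector_mult_def sum_3 axis_def)

lemma rotation_matrix_orthogonality:
  fixes M :: "real^3^3"
  assumes "rotation_matrix M"
  shows "(\<Sum>k\<in>UNIV. M$k$i * M$k$j) = (if i = j then 1 else 0)"
    and "(\<Sum>k\<in>UNIV. M$i$k * M$j$k) = (if i = j then 1 else 0)"
proof -
  have "transpose M ** M = mat 1" "M ** transpose M = mat 1"
    using assms by (auto simp: rotation_matrix_def orthogonal_matrix_def)
  then show "(\<Sum>k\<in>UNIV. M$k$i * M$k$j) = (if i = j then 1 else 0)"
    and "(\<Sum>k\<in>UNIV. M$i$k * M$j$k) = (if i = j then 1 else 0)"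
    by (auto simp: vec_eq_iff matrix_matrix_mult_def transpose_def mat_def)
qed

lemma ex_quat_of_rotation_matrix:
  fixes M :: "real^3^3"
  assumes M: "rotation_matrix M"
  shows "\<exists>a b c d. quat_norm a b c d \<noteq> 0 \<and>
    (\<forall>i j. M $ i $ j = quat_mat a b c d $ i $ j / quat_norm a b c d)"
proof -
  define m11 m12 m13 m21 m22 m23 m31 m32 m33
    where m: "m11 = M$1$1" "m12 = M$1$2" "m13 = M$1$3" "m21 = M$2$1" "m22 = M$2$2"
      "m23 = M$2$3" "m31 = M$3$1" "m32 = M$3$2" "m33 = M$3$3"
  note col = rotation_matrix_orthogonality(1)[OF M, unfolded sum_3]
  note row = rotation_matrix_orthogonality(2)[OF M, unfolded sum_3]
  have rels:
    "m13 - (m21 * m32 - m31 * m22) = 0"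
    "m23 - (m31 * m12 - m11 * m32) = 0"
    "m33 - (m11 * m22 - m21 * m12) = 0"
    "m11 - (m22 * m33 - m32 * m23) = 0"
    "m21 - (m32 * m13 - m12 * m33) = 0"
    "m31 - (m12 * m23 - m22 * m13) = 0"
    "m12 - (m23 * m31 - m33 * m21) = 0"
    "m22 - (m33 * m11 - m13 * m31) = 0"
    "m32 - (m13 * m21 - m23 * m11) = 0"
    unfolding m right_minus_eq by (fact rotation_matrix_cofactors[OF M])+
  have rels':
    "m11 * m11 + m21 * m21 + m31 * m31 - 1 = 0"
    "m11 * m11 + m12 * m12 + m13 * m13 - 1 = 0"
    "m12 * m12 + m22 * m22 + m32 * m32 - 1 = 0"
    "m21 * m21 + m22 * m22 + m23 * m23 - 1 = 0"
    "m13 * m13 + m23 * m23 + m33 * m33 - 1 = 0"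
    "m31 * m31 + m32 * m32 + m33 * m33 - 1 = 0"
    "m11 * m12 + m21 * m22 + m31 * m32 - 0 = 0"
    "m11 * m21 + m12 * m22 + m13 * m23 - 0 = 0"
    "m11 * m13 + m21 * m23 + m31 * m33 - 0 = 0"
    "m11 * m31 + m12 * m32 + m13 * m33 - 0 = 0"
    "m12 * m13 + m22 * m23 + m32 * m33 - 0 = 0"
    "m21 * m31 + m22 * m32 + m23 * m33 - 0 = 0"
    by (simp_all add: m col row)
  have core: ?thesis
    if w: "w \<noteq> 0" and
      eqs: "a * a = w * (1 + m11 + m22 + m33)"
        "b * b = w * (1 + m11 - m22 - m33)"
        "c * c = w * (1 - m11 + m22 - m33)"
        "d * d = w * (1 - m11 - m22 + m33)"
        "a * b = w * (m32 - m23)"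
        "a * c = w * (m13 - m31)"
        "a * d = w * (m21 - m12)"
        "b * c = w * (m12 + m21)"
        "b * d = w * (m13 + m31)"
        "c * d = w * (m23 + m32)"
    for a b c d w
  proof -
    have n: "quat_norm a b c d = 4 * w"
      unfolding quat_norm_def eqs by (simp add: algebra_simps)
    have "\<forall>i j. quat_mat a b c d $ i $ j = 4 * w * M $ i $ j"
      unfolding forall_3 quat_mat_def vector_3 eqs m by (simp add: algebra_simps)
    with n w show ?thesis
      by (intro exI[of _ a] exI[of _ b] exI[of _ c] exI[of _ d]) simp
  qed
  have case0: ?thesis if "(1 + m11 + m22 + m33) \<noteq> 0"
  proof (rule core[OF that])
    show "(1 + m11 + m22 + m33) * (1 + m11 + m22 + m33) = (1 + m11 + m22 + m33) * (1 + m11 + m22 + m33)"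
      by (simp only: mult.commute)
    have "(m32 - m23) * (m32 - m23) - (1 + m11 + m22 + m33) * (1 + m11 - m22 - m33) =
      (-2) * (m11 - (m22 * m33 - m32 * m23)) + (-1) * (m11 * m11 + m12 * m12 + m13 * m13 - 1) + (1) * (m12 * m12 + m22 * m22 + m32 * m32 - 1) + (1) * (m13 * m13 + m23 * m23 + m33 * m33 - 1)"
      by (simp add: algebra_simps)
    then show "(m32 - m23) * (m32 - m23) = (1 + m11 + m22 + m33) * (1 + m11 - m22 - m33)"
      by (simp only: rels rels' mult_zero_right add_0_right right_minus_eq)
    have "(m13 - m31) * (m13 - m31) - (1 + m11 + m22 + m33) * (1 - m11 + m22 - m33) =
      (-2) * (m22 - (m33 * m11 - m13 * m31)) + (1) * (m11 * m11 + m21 * m21 + m31 * m31 - 1) + (-1) * (m21 * m21 + m22 * m22 + m23 * m23 - 1) + (1) * (m13 * m13 + m23 * m23 + m33 * m33 - 1)"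
      by (simp add: algebra_simps)
    then show "(m13 - m31) * (m13 - m31) = (1 + m11 + m22 + m33) * (1 - m11 + m22 - m33)"
      by (simp only: rels rels' mult_zero_right add_0_right right_minus_eq)
    have "(m21 - m12) * (m21 - m12) - (1 + m11 + m22 + m33) * (1 - m11 - m22 + m33) =
      (-2) * (m33 - (m11 * m22 - m21 * m12)) + (1) * (m11 * m11 + m12 * m12 + m13 * m13 - 1) + (1) * (m21 * m21 + m22 * m22 + m23 * m23 - 1) + (-1) * (m13 * m13 + m23 * m23 + m33 * m33 - 1)"
      by (simp add: algebra_simps)
    then show "(m21 - m12) * (m21 - m12) = (1 + m11 + m22 + m33) * (1 - m11 - m22 + m33)"
      by (simp only: rels rels' mult_zero_right add_0_right right_minus_eq)
    show "(1 + m11 + m22 + m33) * (m32 - m23) = (1 + m11 + m22 + m33) * (m32 - m23)"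
      by (simp only: mult.commute)
    show "(1 + m11 + m22 + m33) * (m13 - m31) = (1 + m11 + m22 + m33) * (m13 - m31)"
      by (simp only: mult.commute)
    show "(1 + m11 + m22 + m33) * (m21 - m12) = (1 + m11 + m22 + m33) * (m21 - m12)"
      by (simp only: mult.commute)
    have "(m32 - m23) * (m13 - m31) - (1 + m11 + m22 + m33) * (m12 + m21) =
      (-1) * (m21 - (m32 * m13 - m12 * m33)) + (-1) * (m12 - (m23 * m31 - m33 * m21)) + (-1) * (m11 * m12 + m21 * m22 + m31 * m32 - 0) + (-1) * (m11 * m21 + m12 * m22 + m13 * m23 - 0)"
      by (simp add: algebra_simps)
    then show "(m32 - m23) * (m13 - m31) = (1 + m11 + m22 + m33) * (m12 + m21)"
      by (simp only: rels rels' mult_zero_right add_0_right right_minus_eq)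
    have "(m32 - m23) * (m21 - m12) - (1 + m11 + m22 + m33) * (m13 + m31) =
      (-1) * (m13 - (m21 * m32 - m31 * m22)) + (-1) * (m31 - (m12 * m23 - m22 * m13)) + (-1) * (m11 * m13 + m21 * m23 + m31 * m33 - 0) + (-1) * (m11 * m31 + m12 * m32 + m13 * m33 - 0)"
      by (simp add: algebra_simps)
    then show "(m32 - m23) * (m21 - m12) = (1 + m11 + m22 + m33) * (m13 + m31)"
      by (simp only: rels rels' mult_zero_right add_0_right right_minus_eq)
    have "(m13 - m31) * (m21 - m12) - (1 + m11 + m22 + m33) * (m23 + m32) =
      (-1) * (m23 - (m31 * m12 - m11 * m32)) + (-1) * (m32 - (m13 * m21 - m23 * m11)) + (-1) * (m12 * m13 + m22 * m23 + m32 * m33 - 0) + (-1) * (m21 * m31 + m22 * m32 + m23 * m33 - 0)"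
      by (simp add: algebra_simps)
    then show "(m13 - m31) * (m21 - m12) = (1 + m11 + m22 + m33) * (m23 + m32)"
      by (simp only: rels rels' mult_zero_right add_0_right right_minus_eq)
  qed
  have case1: ?thesis if "(1 + m11 - m22 - m33) \<noteq> 0"
  proof (rule core[OF that])
    have "(m32 - m23) * (m32 - m23) - (1 + m11 - m22 - m33) * (1 + m11 + m22 + m33) =
      (-2) * (m11 - (m22 * m33 - m32 * m23)) + (-1) * (m11 * m11 + m12 * m12 + m13 * m13 - 1) + (1) * (m12 * m12 + m22 * m22 + m32 * m32 - 1) + (1) * (m13 * m13 + m23 * m23 + m33 * m33 - 1)"
      by (simp add: algebra_simps)
    then show "(m32 - m23) * (m32 - m23) = (1 + m11 - m22 - m33) * (1 + m11 + m22 + m33)"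
      by (simp only: rels rels' mult_zero_right add_0_right right_minus_eq)
    show "(1 + m11 - m22 - m33) * (1 + m11 - m22 - m33) = (1 + m11 - m22 - m33) * (1 + m11 - m22 - m33)"
      by (simp only: mult.commute)
    have "(m12 + m21) * (m12 + m21) - (1 + m11 - m22 - m33) * (1 - m11 + m22 - m33) =
      (2) * (m33 - (m11 * m22 - m21 * m12)) + (1) * (m11 * m11 + m12 * m12 + m13 * m13 - 1) + (1) * (m21 * m21 + m22 * m22 + m23 * m23 - 1) + (-1) * (m13 * m13 + m23 * m23 + m33 * m33 - 1)"
      by (simp add: algebra_simps)
    then show "(m12 + m21) * (m12 + m21) = (1 + m11 - m22 - m33) * (1 - m11 + m22 - m33)"
      by (simp only: rels rels' mult_zero_right add_0_right right_minus_eq)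
    have "(m13 + m31) * (m13 + m31) - (1 + m11 - m22 - m33) * (1 - m11 - m22 + m33) =
      (2) * (m22 - (m33 * m11 - m13 * m31)) + (1) * (m11 * m11 + m21 * m21 + m31 * m31 - 1) + (-1) * (m21 * m21 + m22 * m22 + m23 * m23 - 1) + (1) * (m13 * m13 + m23 * m23 + m33 * m33 - 1)"
      by (simp add: algebra_simps)
    then show "(m13 + m31) * (m13 + m31) = (1 + m11 - m22 - m33) * (1 - m11 - m22 + m33)"
      by (simp only: rels rels' mult_zero_right add_0_right right_minus_eq)
    show "(m32 - m23) * (1 + m11 - m22 - m33) = (1 + m11 - m22 - m33) * (m32 - m23)"
      by (simp only: mult.commute)
    have "(m32 - m23) * (m12 + m21) - (1 + m11 - m22 - m33) * (m13 - m31) =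
      (-1) * (m13 - (m21 * m32 - m31 * m22)) + (1) * (m31 - (m12 * m23 - m22 * m13)) + (-1) * (m11 * m13 + m21 * m23 + m31 * m33 - 0) + (1) * (m11 * m31 + m12 * m32 + m13 * m33 - 0)"
      by (simp add: algebra_simps)
    then show "(m32 - m23) * (m12 + m21) = (1 + m11 - m22 - m33) * (m13 - m31)"
      by (simp only: rels rels' mult_zero_right add_0_right right_minus_eq)
    have "(m32 - m23) * (m13 + m31) - (1 + m11 - m22 - m33) * (m21 - m12) =
      (-1) * (m21 - (m32 * m13 - m12 * m33)) + (1) * (m12 - (m23 * m31 - m33 * m21)) + (1) * (m11 * m12 + m21 * m22 + m31 * m32 - 0) + (-1) * (m11 * m21 + m12 * m22 + m13 * m23 - 0)"
      by (simp add: algebra_simps)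
    then show "(m32 - m23) * (m13 + m31) = (1 + m11 - m22 - m33) * (m21 - m12)"
      by (simp only: rels rels' mult_zero_right add_0_right right_minus_eq)
    show "(1 + m11 - m22 - m33) * (m12 + m21) = (1 + m11 - m22 - m33) * (m12 + m21)"
      by (simp only: mult.commute)
    show "(1 + m11 - m22 - m33) * (m13 + m31) = (1 + m11 - m22 - m33) * (m13 + m31)"
      by (simp only: mult.commute)
    have "(m12 + m21) * (m13 + m31) - (1 + m11 - m22 - m33) * (m23 + m32) =
      (-1) * (m23 - (m31 * m12 - m11 * m32)) + (-1) * (m32 - (m13 * m21 - m23 * m11)) + (1) * (m12 * m13 + m22 * m23 + m32 * m33 - 0) + (1) * (m21 * m31 + m22 * m32 + m23 * m33 - 0)"
      by (simp add: algebra_simps)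
    then show "(m12 + m21) * (m13 + m31) = (1 + m11 - m22 - m33) * (m23 + m32)"
      by (simp only: rels rels' mult_zero_right add_0_right right_minus_eq)
  qed
  have case2: ?thesis if "(1 - m11 + m22 - m33) \<noteq> 0"
  proof (rule core[OF that])
    have "(m13 - m31) * (m13 - m31) - (1 - m11 + m22 - m33) * (1 + m11 + m22 + m33) =
      (-2) * (m22 - (m33 * m11 - m13 * m31)) + (1) * (m11 * m11 + m21 * m21 + m31 * m31 - 1) + (-1) * (m21 * m21 + m22 * m22 + m23 * m23 - 1) + (1) * (m13 * m13 + m23 * m23 + m33 * m33 - 1)"
      by (simp add: algebra_simps)
    then show "(m13 - m31) * (m13 - m31) = (1 - m11 + m22 - m33) * (1 + m11 + m22 + m33)"
      by (simp only: rels rels' mult_zero_right add_0_right right_minus_eq)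
    have "(m12 + m21) * (m12 + m21) - (1 - m11 + m22 - m33) * (1 + m11 - m22 - m33) =
      (2) * (m33 - (m11 * m22 - m21 * m12)) + (1) * (m11 * m11 + m12 * m12 + m13 * m13 - 1) + (1) * (m21 * m21 + m22 * m22 + m23 * m23 - 1) + (-1) * (m13 * m13 + m23 * m23 + m33 * m33 - 1)"
      by (simp add: algebra_simps)
    then show "(m12 + m21) * (m12 + m21) = (1 - m11 + m22 - m33) * (1 + m11 - m22 - m33)"
      by (simp only: rels rels' mult_zero_right add_0_right right_minus_eq)
    show "(1 - m11 + m22 - m33) * (1 - m11 + m22 - m33) = (1 - m11 + m22 - m33) * (1 - m11 + m22 - m33)"
      by (simp only: mult.commute)
    have "(m23 + m32) * (m23 + m32) - (1 - m11 + m22 - m33) * (1 - m11 - m22 + m33) =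
      (2) * (m11 - (m22 * m33 - m32 * m23)) + (-1) * (m11 * m11 + m12 * m12 + m13 * m13 - 1) + (1) * (m12 * m12 + m22 * m22 + m32 * m32 - 1) + (1) * (m13 * m13 + m23 * m23 + m33 * m33 - 1)"
      by (simp add: algebra_simps)
    then show "(m23 + m32) * (m23 + m32) = (1 - m11 + m22 - m33) * (1 - m11 - m22 + m33)"
      by (simp only: rels rels' mult_zero_right add_0_right right_minus_eq)
    have "(m13 - m31) * (m12 + m21) - (1 - m11 + m22 - m33) * (m32 - m23) =
      (1) * (m23 - (m31 * m12 - m11 * m32)) + (-1) * (m32 - (m13 * m21 - m23 * m11)) + (1) * (m12 * m13 + m22 * m23 + m32 * m33 - 0) + (-1) * (m21 * m31 + m22 * m32 + m23 * m33 - 0)"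
      by (simp add: algebra_simps)
    then show "(m13 - m31) * (m12 + m21) = (1 - m11 + m22 - m33) * (m32 - m23)"
      by (simp only: rels rels' mult_zero_right add_0_right right_minus_eq)
    show "(m13 - m31) * (1 - m11 + m22 - m33) = (1 - m11 + m22 - m33) * (m13 - m31)"
      by (simp only: mult.commute)
    have "(m13 - m31) * (m23 + m32) - (1 - m11 + m22 - m33) * (m21 - m12) =
      (-1) * (m21 - (m32 * m13 - m12 * m33)) + (1) * (m12 - (m23 * m31 - m33 * m21)) + (-1) * (m11 * m12 + m21 * m22 + m31 * m32 - 0) + (1) * (m11 * m21 + m12 * m22 + m13 * m23 - 0)"
      by (simp add: algebra_simps)
    then show "(m13 - m31) * (m23 + m32) = (1 - m11 + m22 - m33) * (m21 - m12)"
      by (simp only: rels rels' mult_zero_right add_0_right right_minus_eq)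
    show "(m12 + m21) * (1 - m11 + m22 - m33) = (1 - m11 + m22 - m33) * (m12 + m21)"
      by (simp only: mult.commute)
    have "(m12 + m21) * (m23 + m32) - (1 - m11 + m22 - m33) * (m13 + m31) =
      (-1) * (m13 - (m21 * m32 - m31 * m22)) + (-1) * (m31 - (m12 * m23 - m22 * m13)) + (1) * (m11 * m13 + m21 * m23 + m31 * m33 - 0) + (1) * (m11 * m31 + m12 * m32 + m13 * m33 - 0)"
      by (simp add: algebra_simps)
    then show "(m12 + m21) * (m23 + m32) = (1 - m11 + m22 - m33) * (m13 + m31)"
      by (simp only: rels rels' mult_zero_right add_0_right right_minus_eq)
    show "(1 - m11 + m22 - m33) * (m23 + m32) = (1 - m11 + m22 - m33) * (m23 + m32)"
      by (simp only: mult.commute)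
  qed
  have case3: ?thesis if "(1 - m11 - m22 + m33) \<noteq> 0"
  proof (rule core[OF that])
    have "(m21 - m12) * (m21 - m12) - (1 - m11 - m22 + m33) * (1 + m11 + m22 + m33) =
      (-2) * (m33 - (m11 * m22 - m21 * m12)) + (1) * (m11 * m11 + m12 * m12 + m13 * m13 - 1) + (1) * (m21 * m21 + m22 * m22 + m23 * m23 - 1) + (-1) * (m13 * m13 + m23 * m23 + m33 * m33 - 1)"
      by (simp add: algebra_simps)
    then show "(m21 - m12) * (m21 - m12) = (1 - m11 - m22 + m33) * (1 + m11 + m22 + m33)"
      by (simp only: rels rels' mult_zero_right add_0_right right_minus_eq)
    have "(m13 + m31) * (m13 + m31) - (1 - m11 - m22 + m33) * (1 + m11 - m22 - m33) =
      (2) * (m22 - (m33 * m11 - m13 * m31)) + (1) * (m11 * m11 + m21 * m21 + m31 * m31 - 1) + (-1) * (m21 * m21 + m22 * m22 + m23 * m23 - 1) + (1) * (m13 * m13 + m23 * m23 + m33 * m33 - 1)"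
      by (simp add: algebra_simps)
    then show "(m13 + m31) * (m13 + m31) = (1 - m11 - m22 + m33) * (1 + m11 - m22 - m33)"
      by (simp only: rels rels' mult_zero_right add_0_right right_minus_eq)
    have "(m23 + m32) * (m23 + m32) - (1 - m11 - m22 + m33) * (1 - m11 + m22 - m33) =
      (2) * (m11 - (m22 * m33 - m32 * m23)) + (-1) * (m11 * m11 + m12 * m12 + m13 * m13 - 1) + (1) * (m12 * m12 + m22 * m22 + m32 * m32 - 1) + (1) * (m13 * m13 + m23 * m23 + m33 * m33 - 1)"
      by (simp add: algebra_simps)
    then show "(m23 + m32) * (m23 + m32) = (1 - m11 - m22 + m33) * (1 - m11 + m22 - m33)"
      by (simp only: rels rels' mult_zero_right add_0_right right_minus_eq)
    show "(1 - m11 - m22 + m33) * (1 - m11 - m22 + m33) = (1 - m11 - m22 + m33) * (1 - m11 - m22 + m33)"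
      by (simp only: mult.commute)
    have "(m21 - m12) * (m13 + m31) - (1 - m11 - m22 + m33) * (m32 - m23) =
      (1) * (m23 - (m31 * m12 - m11 * m32)) + (-1) * (m32 - (m13 * m21 - m23 * m11)) + (-1) * (m12 * m13 + m22 * m23 + m32 * m33 - 0) + (1) * (m21 * m31 + m22 * m32 + m23 * m33 - 0)"
      by (simp add: algebra_simps)
    then show "(m21 - m12) * (m13 + m31) = (1 - m11 - m22 + m33) * (m32 - m23)"
      by (simp only: rels rels' mult_zero_right add_0_right right_minus_eq)
    have "(m21 - m12) * (m23 + m32) - (1 - m11 - m22 + m33) * (m13 - m31) =
      (-1) * (m13 - (m21 * m32 - m31 * m22)) + (1) * (m31 - (m12 * m23 - m22 * m13)) + (1) * (m11 * m13 + m21 * m23 + m31 * m33 - 0) + (-1) * (m11 * m31 + m12 * m32 + m13 * m33 - 0)"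
      by (simp add: algebra_simps)
    then show "(m21 - m12) * (m23 + m32) = (1 - m11 - m22 + m33) * (m13 - m31)"
      by (simp only: rels rels' mult_zero_right add_0_right right_minus_eq)
    show "(m21 - m12) * (1 - m11 - m22 + m33) = (1 - m11 - m22 + m33) * (m21 - m12)"
      by (simp only: mult.commute)
    have "(m13 + m31) * (m23 + m32) - (1 - m11 - m22 + m33) * (m12 + m21) =
      (-1) * (m21 - (m32 * m13 - m12 * m33)) + (-1) * (m12 - (m23 * m31 - m33 * m21)) + (1) * (m11 * m12 + m21 * m22 + m31 * m32 - 0) + (1) * (m11 * m21 + m12 * m22 + m13 * m23 - 0)"
      by (simp add: algebra_simps)
    then show "(m13 + m31) * (m23 + m32) = (1 - m11 - m22 + m33) * (m12 + m21)"
      by (simp only: rels rels' mult_zero_right add_0_right right_minus_eq)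
    show "(m13 + m31) * (1 - m11 - m22 + m33) = (1 - m11 - m22 + m33) * (m13 + m31)"
      by (simp only: mult.commute)
    show "(m23 + m32) * (1 - m11 - m22 + m33) = (1 - m11 - m22 + m33) * (m23 + m32)"
      by (simp only: mult.commute)
  qed
  have "(1 + m11 + m22 + m33) \<noteq> 0 \<or> (1 + m11 - m22 - m33) \<noteq> 0 \<or>
      (1 - m11 + m22 - m33) \<noteq> 0 \<or> (1 - m11 - m22 + m33) \<noteq> 0"
    by linarith
  then show ?thesis
    using case0 case1 case2 case3 by blast
qed

lemma real_polynomial_function_rational_curve:
  fixes n :: "real poly" and e :: "3 \<Rightarrow> 3 \<Rightarrow> real poly" and p :: "real^3^3 \<Rightarrow> real"
  assumes "real_polynomial_function p"
  shows "\<exists>k P. \<forall>t. poly n t \<noteq> 0 \<longrightarrow>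
    poly n t ^ k * p (\<chi> i j. poly (e i j) t / poly n t) = poly P t"
  using assms
proof (induction p rule: real_polynomial_function.induct)
  case (linear p)
  let ?b = "\<lambda>i j. axis i (axis j 1) :: real^3^3"
  have lin: "p A = (\<Sum>i\<in>UNIV. \<Sum>j\<in>UNIV. A $ i $ j * p (?b i j))" for A :: "real^3^3"
  proof -
    have "A = (\<Sum>i\<in>UNIV. \<Sum>j\<in>UNIV. (A $ i $ j) *\<^sub>R ?b i j)"
      by (simp add: vec_eq_iff axis_def sum_3 forall_3)
    then have "p A = p (\<Sum>i\<in>UNIV. \<Sum>j\<in>UNIV. (A $ i $ j) *\<^sub>R ?b i j)"
      by simp
    also have "\<dots> = (\<Sum>i\<in>UNIV. \<Sum>j\<in>UNIV. A $ i $ j * p (?b i j))"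
      using bounded_linear.linear[OF linear] by (simp add: linear_sum linear_scale)
    finally show ?thesis .
  qed
  let ?P = "\<Sum>i\<in>UNIV. \<Sum>j\<in>UNIV. e i j * [:p (?b i j):]"
  have "poly n t ^ 1 * p (\<chi> i j. poly (e i j) t / poly n t) = poly ?P t" if "poly n t \<noteq> 0" for t
    using that by (subst lin) (simp add: poly_sum sum_distrib_left mult.commute)
  then show ?case by blast
next
  case (const c)
  have "poly n t ^ 0 * c = poly [:c:] t" for t by simp
  then show ?case by blast
next
  case (add f g)
  then obtain k P l Q where
    "\<And>t. poly n t \<noteq> 0 \<Longrightarrow> poly n t ^ k * f (\<chi> i j. poly (e i j) t / poly n t) = poly P t"
    "\<And>t. poly n t \<noteq> 0 \<Longrightarrow> poly n t ^ l * g (\<chi> i j. poly (e i j) t / poly n t) = poly Q t"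
    by blast
  then have "poly n t ^ (k + l) * (f (\<chi> i j. poly (e i j) t / poly n t) +
      g (\<chi> i j. poly (e i j) t / poly n t)) = poly (n ^ l * P + n ^ k * Q) t"
    if "poly n t \<noteq> 0" for t
    using that by (simp add: power_add algebra_simps flip: \<open>\<And>t. _ \<Longrightarrow> _ = poly P t\<close> \<open>\<And>t. _ \<Longrightarrow> _ = poly Q t\<close>)
  then show ?case by blast
next
  case (mult f g)
  then obtain k P l Q where
    "\<And>t. poly n t \<noteq> 0 \<Longrightarrow> poly n t ^ k * f (\<chi> i j. poly (e i j) t / poly n t) = poly P t"
    "\<And>t. poly n t \<noteq> 0 \<Longrightarrow> poly n t ^ l * g (\<chi> i j. poly (e i j) t / poly n t) = poly Q t"
    by blast
  then have "poly n t ^ (k + l) * (f (\<chi> i j. poly (e i j) t / poly n t) *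
      g (\<chi> i j. poly (e i j) t / poly n t)) = poly (P * Q) t"
    if "poly n t \<noteq> 0" for t
    using that by (simp add: power_add algebra_simps flip: \<open>\<And>t. _ \<Longrightarrow> _ = poly P t\<close> \<open>\<And>t. _ \<Longrightarrow> _ = poly Q t\<close>)
  then show ?case by blast
qed

lemma SO3_irreducible:
  assumes p: "real_polynomial_function p" and q: "real_polynomial_function q"
    and pq: "\<And>M :: real^3^3. rotation_matrix M \<Longrightarrow> p M * q M = 0"
    and M: "rotation_matrix M" "p M \<noteq> 0" and N: "rotation_matrix N"
  shows "q N = 0"
proof (rule ccontr)
  assume qN: "q N \<noteq> 0"
  obtain a b c d where M': "quat_norm a b c d \<noteq> 0"
      "\<And>i j. M $ i $ j = quat_mat a b c d $ i $ j / quat_norm a b c d"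
    using ex_quat_of_rotation_matrix[OF M(1)] by blast
  obtain a' b' c' d' where N': "quat_norm a' b' c' d' \<noteq> 0"
      "\<And>i j. N $ i $ j = quat_mat a' b' c' d' $ i $ j / quat_norm a' b' c' d'"
    using ex_quat_of_rotation_matrix[OF N] by blast
  define L where "L x y = [:x, y - x:]" for x y :: real
  define n where "n = quat_norm (L a a') (L b b') (L c c') (L d d')"
  define e where "e i j = quat_mat (L a a') (L b b') (L c c') (L d d') $ i $ j" for i j
  let ?l = "\<lambda>x y t. x + t * (y - x)"
  have n: "poly n t = quat_norm (?l a a' t) (?l b b' t) (?l c c' t) (?l d d' t)" for t
    by (simp add: n_def L_def quat_norm_def algebra_simps)
  have e: "poly (e i j) t = quat_mat (?l a a' t) (?l b b' t) (?l c c' t) (?l d d' t) $ i $ j" for i j t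
  proof -
    have "\<forall>i j. poly (e i j) t = quat_mat (?l a a' t) (?l b b' t) (?l c c' t) (?l d d' t) $ i $ j"
      unfolding e_def quat_mat_def forall_3 vector_3 by (simp add: L_def algebra_simps)
    then show ?thesis by blast
  qed
  let ?c = "\<lambda>t. (\<chi> i j. poly (e i j) t / poly n t) :: real^3^3"
  have c0: "?c 0 = M" "poly n 0 \<noteq> 0" and c1: "?c 1 = N" "poly n 1 \<noteq> 0"
    unfolding vec_eq_iff n e by (simp_all add: M' N')
  have rot: "rotation_matrix (?c t)" if "poly n t \<noteq> 0" for t
    using rotation_matrix_quat_mat that unfolding n e by blast
  obtain k P where P: "\<And>t. poly n t \<noteq> 0 \<Longrightarrow> poly n t ^ k * p (?c t) = poly P t"
    using real_polynomial_function_rational_curve[OF p] by blast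
  obtain l Q where Q: "\<And>t. poly n t \<noteq> 0 \<Longrightarrow> poly n t ^ l * q (?c t) = poly Q t"
    using real_polynomial_function_rational_curve[OF q] by blast
  have "poly (n * P * Q) t = 0" for t
  proof (cases "poly n t = 0")
    case False
    have "poly P t * poly Q t = poly n t ^ k * poly n t ^ l * (p (?c t) * q (?c t))"
      unfolding P[OF False, symmetric] Q[OF False, symmetric] by (simp only: mult_ac)
    then show ?thesis using pq[OF rot[OF False]] by simp
  qed simp
  then have "n * P * Q = 0"
    using poly_all_0_iff_0 by blast
  moreover have "n \<noteq> 0" using c0 by auto
  moreover have "poly P 0 \<noteq> 0" using P[OF c0(2)] c0 M(2) by (metis mult_eq_0_iff power_not_zero)
  moreover have "poly Q 1 \<noteq> 0" using Q[OF c1(2)] c1 qN by (metis mult_eq_0_iff power_not_zero)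
  ultimately show False by auto
qed


section \<open>The function field of \<open>SO(3)\<close>\<close>

typedef so3 = "{M :: real^3^3. rotation_matrix M}"
  morphisms mat_of_so3 so3_of_mat
proof
  show "mat 1 \<in> {M :: real^3^3. rotation_matrix M}"
    by (simp add: rotation_matrix_def orthogonal_matrix_id)
qed

text \<open>
  The coordinate ring \<open>\<real>[SO(3)]\<close>. Real polynomials in the matrix entries are identified when they
  agree on the real points of \<open>SO(3)\<close>, which are Zariski dense.
\<close>

typedef so3_fun = "{f :: so3 \<Rightarrow> real. \<exists>p. real_polynomial_function p \<and> f = p \<circ> mat_of_so3}"
  morphisms so3_eval so3_fun_of
  by blast

setup_lifting type_definition_so3_fun

instantiation so3_fun :: comm_ring_1
begin

lift_definition zero_so3_fun :: so3_fun is "\<lambda>_. 0"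
  by (rule exI[of _ "\<lambda>_. 0"]) auto

lift_definition one_so3_fun :: so3_fun is "\<lambda>_. 1"
  by (rule exI[of _ "\<lambda>_. 1"]) auto

lift_definition plus_so3_fun :: "so3_fun \<Rightarrow> so3_fun \<Rightarrow> so3_fun" is "\<lambda>f g M. f M + g M"
proof -
  fix f g :: "so3 \<Rightarrow> real"
  assume "\<exists>p. real_polynomial_function p \<and> f = p \<circ> mat_of_so3"
    and "\<exists>q. real_polynomial_function q \<and> g = q \<circ> mat_of_so3"
  then obtain p q where "real_polynomial_function p" "f = p \<circ> mat_of_so3"
    and "real_polynomial_function q" "g = q \<circ> mat_of_so3"
    by blast
  then show "\<exists>r. real_polynomial_function r \<and> (\<lambda>M. f M + g M) = r \<circ> mat_of_so3"
    by (intro exI[of _ "\<lambda>x. p x + q x"]) auto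
qed

lift_definition times_so3_fun :: "so3_fun \<Rightarrow> so3_fun \<Rightarrow> so3_fun" is "\<lambda>f g M. f M * g M"
proof -
  fix f g :: "so3 \<Rightarrow> real"
  assume "\<exists>p. real_polynomial_function p \<and> f = p \<circ> mat_of_so3"
    and "\<exists>q. real_polynomial_function q \<and> g = q \<circ> mat_of_so3"
  then obtain p q where "real_polynomial_function p" "f = p \<circ> mat_of_so3"
    and "real_polynomial_function q" "g = q \<circ> mat_of_so3"
    by blast
  then show "\<exists>r. real_polynomial_function r \<and> (\<lambda>M. f M * g M) = r \<circ> mat_of_so3"
    by (intro exI[of _ "\<lambda>x. p x * q x"]) auto
qed

lift_definition uminus_so3_fun :: "so3_fun \<Rightarrow> so3_fun" is "\<lambda>f M. - f M"
proof -
  fix f :: "so3 \<Rightarrow> real"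
  assume "\<exists>p. real_polynomial_function p \<and> f = p \<circ> mat_of_so3"
  then obtain p where "real_polynomial_function p" "f = p \<circ> mat_of_so3"
    by blast
  then show "\<exists>r. real_polynomial_function r \<and> (\<lambda>M. - f M) = r \<circ> mat_of_so3"
    by (intro exI[of _ "\<lambda>x. - p x"]) auto
qed

lift_definition minus_so3_fun :: "so3_fun \<Rightarrow> so3_fun \<Rightarrow> so3_fun" is "\<lambda>f g M. f M - g M"
proof -
  fix f g :: "so3 \<Rightarrow> real"
  assume "\<exists>p. real_polynomial_function p \<and> f = p \<circ> mat_of_so3"
    and "\<exists>q. real_polynomial_function q \<and> g = q \<circ> mat_of_so3"
  then obtain p q where "real_polynomial_function p" "f = p \<circ> mat_of_so3"
    and "real_polynomial_function q" "g = q \<circ> mat_of_so3"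
    by blast
  then show "\<exists>r. real_polynomial_function r \<and> (\<lambda>M. f M - g M) = r \<circ> mat_of_so3"
    by (intro exI[of _ "\<lambda>x. p x - q x"]) auto
qed

instance
  by standard (transfer; simp add: fun_eq_iff algebra_simps)+

end

instance so3_fun :: idom
proof
  fix f g :: so3_fun
  assume "f \<noteq> 0" "g \<noteq> 0"
  then show "f * g \<noteq> 0"
  proof transfer
    fix f g :: "so3 \<Rightarrow> real"
    assume "\<exists>p. real_polynomial_function p \<and> f = p \<circ> mat_of_so3"
      and "\<exists>q. real_polynomial_function q \<and> g = q \<circ> mat_of_so3"
      and "f \<noteq> (\<lambda>_. 0)" and "g \<noteq> (\<lambda>_. 0)"
    then obtain p q M N where p: "real_polynomial_function p" "f = p \<circ> mat_of_so3"
      and q: "real_polynomial_function q" "g = q \<circ> mat_of_so3"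
      and MN: "f M \<noteq> 0" "g N \<noteq> 0"
      by (auto simp: fun_eq_iff)
    show "(\<lambda>M. f M * g M) \<noteq> (\<lambda>_. 0)"
    proof
      assume "(\<lambda>M. f M * g M) = (\<lambda>_. 0)"
      then have "p (mat_of_so3 R) * q (mat_of_so3 R) = 0" for R
        by (simp add: p q fun_eq_iff)
      then have "p M' * q M' = 0" if "rotation_matrix M'" for M'
        using that by (metis mem_Collect_eq so3_of_mat_inverse)
      from SO3_irreducible[OF p(1) q(1) this, of "mat_of_so3 M" "mat_of_so3 N"]
      show False using MN mat_of_so3 p(2) q(2) by auto
    qed
  qed
qed

lift_definition so3_const :: "real \<Rightarrow> so3_fun" is "\<lambda>c _. c"
  by (rule exI[of _ "\<lambda>_. _"]) auto

lift_definition so3_entry :: "3 \<Rightarrow> 3 \<Rightarrow> so3_fun" is "\<lambda>i j M. mat_of_so3 M $ i $ j"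
proof -
  fix i j :: 3
  have "bounded_linear (\<lambda>M :: real^3^3. M $ i $ j)"
    by (intro bounded_linear_compose[OF bounded_linear_vec_nth bounded_linear_vec_nth])
  then show "\<exists>p. real_polynomial_function p \<and> (\<lambda>M. mat_of_so3 M $ i $ j) = p \<circ> mat_of_so3"
    by (intro exI[of _ "\<lambda>M. M $ i $ j"]) auto
qed

text \<open>The field \<open>K = \<real>(SO(3))\<close>, its constants, and the generic rotation matrix.\<close>

type_synonym so3_field = "so3_fun fract"

definition K_of_real :: "real \<Rightarrow> so3_field" where
  "K_of_real c = Fract (so3_const c) 1"

definition generic_rotation :: "so3_field^3^3" where
  "generic_rotation = (\<chi> i j. Fract (so3_entry i j) 1)"


section \<open>Affine varieties and birational equivalence\<close>

text \<open>
  The coordinates of affine space are indexed by a finite type \<open>'n\<close>, so that its coordinate ring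
  is the polynomial ring \<open>('n, 'k) mpoly\<close>. A monomial is its exponent vector \<open>'n \<Rightarrow>\<^sub>0 nat\<close>.
\<close>

type_synonym ('n, 'k) mpoly = "('n \<Rightarrow>\<^sub>0 nat) \<Rightarrow>\<^sub>0 'k"

definition mpoly_const :: "'k::zero \<Rightarrow> ('n, 'k) mpoly" where
  "mpoly_const c = Poly_Mapping.single 0 c"

definition mpoly_var :: "'n \<Rightarrow> ('n, 'k::zero_neq_one) mpoly" where
  "mpoly_var i = Poly_Mapping.single (Poly_Mapping.single i 1) 1"

type_synonym ('n, 'k) ratfun = "('n, 'k) mpoly fract"

text \<open>Substitution of rational functions \<open>f\<^sub>i\<close> in the variables \<open>'m\<close> for the variables \<open>'n\<close>.\<close>

definition mpoly_subst ::
  "('m::{finite,linorder}, 'k::field) ratfun^'n \<Rightarrow> ('n::finite, 'k) mpoly \<Rightarrow> ('m, 'k) ratfun" where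
  "mpoly_subst f p = (\<Sum>m\<in>Poly_Mapping.keys p.
     Fract (mpoly_const (Poly_Mapping.lookup p m)) 1 *
       (\<Prod>i\<in>UNIV. (f $ i) ^ Poly_Mapping.lookup m i))"

definition prime_ideal :: "'a::comm_ring_1 set \<Rightarrow> bool" where
  "prime_ideal I \<longleftrightarrow> 0 \<in> I \<and> 1 \<notin> I \<and> (\<forall>a\<in>I. \<forall>b\<in>I. a + b \<in> I) \<and> (\<forall>r. \<forall>a\<in>I. r * a \<in> I) \<and>
     (\<forall>a b. a * b \<in> I \<longrightarrow> a \<in> I \<or> b \<in> I)"

text \<open>
  A closed subscheme of affine space over \<open>'k\<close> is given by its ideal \<open>I\<close>; it is a variety
  (integral, but not necessarily geometrically so) iff \<open>I\<close> is prime. Rational functions on the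
  variety of a prime ideal \<open>I\<close> are represented by elements of the local ring at its generic point,
  i.e. by fractions whose denominator does not vanish identically on the variety. Two of them are
  equal on the variety iff their difference lies in the maximal ideal of that local ring.
\<close>

definition regular_at :: "('n::{finite,linorder}, 'k::field) mpoly set \<Rightarrow> ('n, 'k) ratfun set" where
  "regular_at I = {Fract p q | p q. q \<notin> I}"

definition vanishing_on :: "('n::{finite,linorder}, 'k::field) mpoly set \<Rightarrow> ('n, 'k) ratfun set" where
  "vanishing_on I = {Fract p q | p q. p \<in> I \<and> q \<notin> I}"

text \<open>
  The rational functions \<open>f\<close> on the variety of \<open>I\<close> define a dominant rational map to the variety
  of \<open>J\<close>: a polynomial vanishes on the image of \<open>f\<close> iff it vanishes on the variety of \<open>J\<close>.
\<close>

definition dominant_rational_map ::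
  "('m::{finite,linorder}, 'k::field) mpoly set \<Rightarrow> ('n::finite, 'k) mpoly set \<Rightarrow>
    (('m, 'k) ratfun, 'n) vec \<Rightarrow> bool" where
  "dominant_rational_map I J f \<longleftrightarrow>
     (\<forall>j. f $ j \<in> regular_at I) \<and> (\<forall>p. mpoly_subst f p \<in> vanishing_on I \<longleftrightarrow> p \<in> J)"

text \<open>
  For dominant rational maps \<open>f\<close> from \<open>I\<close> to \<open>J\<close> and \<open>g\<close> from \<open>J\<close> to \<open>I\<close>, the composition of \<open>g\<close>
  after \<open>f\<close> is the identity. By dominance of \<open>f\<close> the denominator \<open>mpoly_subst f q\<close> does not vanish
  on \<open>I\<close>, and the condition does not depend on the choice of \<open>p\<close> and \<open>q\<close>.
\<close>

definition comp_is_identity ::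
  "('m::{finite,linorder}, 'k::field) mpoly set \<Rightarrow> ('n::{finite,linorder}, 'k) mpoly set \<Rightarrow>
    (('m, 'k) ratfun, 'n) vec \<Rightarrow> (('n, 'k) ratfun, 'm) vec \<Rightarrow> bool" where
  "comp_is_identity I J f g \<longleftrightarrow>
     (\<forall>i. \<exists>p q. q \<notin> J \<and> g $ i = Fract p q \<and>
        mpoly_subst f p / mpoly_subst f q - Fract (mpoly_var i) 1 \<in> vanishing_on I)"

definition birationally_equivalent ::
  "('m::{finite,linorder}, 'k::field) mpoly set \<Rightarrow> ('n::{finite,linorder}, 'k) mpoly set \<Rightarrow> bool" where
  "birationally_equivalent I J \<longleftrightarrow> prime_ideal I \<and> prime_ideal J \<and>
     (\<exists>f g. dominant_rational_map I J f \<and> dominant_rational_map J I g \<and>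
        comp_is_identity I J f g \<and> comp_is_identity J I g f)"

definition affine_plane :: "(2, 'k::field) mpoly set" where
  "affine_plane = {0}"


section \<open>Gough--Stewart platforms\<close>

text \<open>The six legs are indexed by the type \<open>6\<close>, in which \<open>6 = 0\<close>.\<close>

type_synonym architecture = "((real^3)^6) \<times> ((real^3)^6)"

definition architectures :: "architecture set" where
  "architectures = {(A, b). A $ 1 = 0 \<and> b $ 1 = 0}"

definition zariski_open_in :: "'a::euclidean_space set \<Rightarrow> 'a set \<Rightarrow> bool" where
  "zariski_open_in V U \<longleftrightarrow>
     (\<exists>F. (\<forall>f\<in>F. real_polynomial_function f) \<and> U = {x\<in>V. \<exists>f\<in>F. f x \<noteq> 0})"

definition map_vec :: "('a \<Rightarrow> 'b) \<Rightarrow> 'a^'n \<Rightarrow> 'b^'n" where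
  "map_vec h v = (\<chi> i. h (v $ i))"

definition cross :: "'a::comm_ring_1^3 \<Rightarrow> 'a^3 \<Rightarrow> 'a^3" where
  "cross v w = vector [v$2 * w$3 - v$3 * w$2, v$3 * w$1 - v$1 * w$3, v$1 * w$2 - v$2 * w$1]"

definition leg_offset :: "architecture \<Rightarrow> 6 \<Rightarrow> so3_field^3" where
  "leg_offset = (\<lambda>(A, b) i.
     generic_rotation *v map_vec K_of_real (b $ i) - map_vec K_of_real (A $ i))"

definition leg :: "architecture \<Rightarrow> 6 \<Rightarrow> (3, so3_field) mpoly^3" where
  "leg a i = map_vec mpoly_const (leg_offset a i) + (\<chi> k. mpoly_var k)"

definition Jac :: "architecture \<Rightarrow> (3, so3_field) mpoly^6^6" where
  "Jac a = (\<chi> i.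
     let v = leg a i; w = cross (map_vec (\<lambda>c. mpoly_const (K_of_real c)) (fst a $ i)) v
     in vector [v$1, v$2, v$3, w$1, w$2, w$3])"

definition Sigma_surface :: "architecture \<Rightarrow> (3, so3_field) mpoly set" where
  "Sigma_surface a = {p. det (Jac a) dvd p}"

end

(*
  At a singular pose the platform has an infinitesimal motion preserving the leg lengths, i.e. a
  kernel vector (u, w) of Jac, with w its angular velocity. The first leg gives P . u = 0. With
  s = P x w, the other legs give five linear equations for (u, s) whose coefficients do not involve
  P, and w . s = 0 is a sixth; so (u, s) is determined by w, and P = (u x s) / (u . w). Thus the
  directions w, a projective plane, parametrise the surface, and the inverse map takes P to the
  angular velocity of the motion at P, which is given by minors of Jac.

  For the ideal-theoretic statement let D = det Jac and let g be the parametrisation. Substituting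
  w(P) into p(g) = 0 shows that p(g) = 0 implies D | h^n p, where h is the denominator of g at w(P).
  To cancel h, consider the lines in the direction C_2. The line through the origin meets the
  surface at P = 0, at P = - C_2 and at a third point, which is therefore rational; generically h does
  not vanish at any of them, and this already makes h a nonzerodivisor modulo D. So D generates the
  kernel of g, which also shows that D is irreducible.
*)

theory Submission
  imports Defs
begin

text \<open>The obstacle is the cancellation of \<open>h\<close> in \<open>D dvd h * p\<close>:
  nothing is known about the irreducibility of \<open>D\<close> beforehand, so it does not suffice
  that \<open>h\<close> is no multiple of \<open>D\<close>. A criterion that inspects three points
  of one line takes its place. Two of the points lie on the surface because a leg has length zero
  there, the first leg at the origin and the second at \<open>- C\<^sub>2\<close>; a cubic with two
  zeros in the field has its third there too. To see all of space and not just this line, the line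
  is displaced by \<lambda> times the generic point \<open>X\<close>: \<lambda> = 0 is the fixed
  line, and \<lambda> = 1 contains \<open>X\<close>, where a polynomial takes itself as value.

  All generic conditions are multiplied into one expression, \<open>general_position\<close>, that
  is free of division. It therefore commutes with ring homomorphisms: it is a regular function on
  \<open>SO(3)\<close> for a fixed architecture and a polynomial in the architecture for a fixed
  rotation. A single integer example at the identity rotation then shows that the open set is
  nonempty.\<close>

section \<open>Ring homomorphisms and evaluation of polynomials\<close>

text \<open>The constructions below are polynomial in the entries of their arguments and hence
  commute with ring homomorphisms. Identities can so be moved between polynomial rings, their
  fraction fields, \<open>so3_field\<close> and the reals.\<close>

locale cring_hom =
  fixes \<phi> :: "'a::comm_ring_1 \<Rightarrow> 'b::comm_ring_1"
  assumes hom_one: "\<phi> 1 = 1"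
    and hom_add: "\<phi> (a + b) = \<phi> a + \<phi> b"
    and hom_mult: "\<phi> (a * b) = \<phi> a * \<phi> b"
begin

lemma hom_zero: "\<phi> 0 = 0"
  using hom_add[of 0 0] by simp

lemma hom_minus: "\<phi> (- a) = - \<phi> a"
  using hom_add[of a "- a"] by (simp add: hom_zero eq_neg_iff_add_eq_0 add.commute)

lemma hom_diff: "\<phi> (a - b) = \<phi> a - \<phi> b"
  using hom_add[of a "- b"] by (simp add: hom_minus)

lemma hom_power: "\<phi> (a ^ n) = \<phi> a ^ n"
  by (induction n) (simp_all add: hom_one hom_mult)

lemma hom_sum: "\<phi> (sum f S) = (\<Sum>x\<in>S. \<phi> (f x))"
  by (induction S rule: infinite_finite_induct) (simp_all add: hom_zero hom_add)

lemma hom_prod: "\<phi> (prod f S) = (\<Prod>x\<in>S. \<phi> (f x))"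
  by (induction S rule: infinite_finite_induct) (simp_all add: hom_one hom_mult)

lemma hom_of_nat: "\<phi> (of_nat n) = of_nat n"
  by (induction n) (simp_all add: hom_zero hom_one hom_add)

lemma hom_of_int: "\<phi> (of_int k) = of_int k"
  by (cases k rule: int_cases2) (simp_all add: hom_of_nat hom_minus)

lemma hom_numeral: "\<phi> (numeral k) = numeral k"
  using hom_of_nat[of "numeral k"] by simp

lemma hom_det: "\<phi> (det M) = det (map_vec (map_vec \<phi>) M)"
  by (simp add: det_def hom_sum hom_prod hom_mult hom_of_int map_vec_def)

lemma hom_dvd: "a dvd b \<Longrightarrow> \<phi> a dvd \<phi> b"
  by (auto simp: dvd_def hom_mult)

end

lemma cring_hom_comp:
  assumes "cring_hom \<phi>" "cring_hom \<psi>"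
  shows "cring_hom (\<lambda>x. \<psi> (\<phi> x))"
proof -
  interpret a: cring_hom \<phi> by fact
  interpret b: cring_hom \<psi> by fact
  show ?thesis
    by standard (simp_all add: a.hom_one a.hom_add a.hom_mult b.hom_one b.hom_add b.hom_mult)
qed

lemma cring_hom_Fract: "cring_hom (\<lambda>a::'a::idom. Fract a 1)"
  by standard (simp_all add: One_fract_def)

lemma cring_hom_mpoly_const:
  "cring_hom (mpoly_const :: 'k \<Rightarrow> ('n, 'k::comm_ring_1) mpoly)"
  by standard (simp_all add: mpoly_const_def single_add mult_single)

lemma cring_hom_const_poly: "cring_hom (\<lambda>a::'a::comm_ring_1. [:a:])"
  by standard simp_all

lemma cring_hom_poly: "cring_hom (\<lambda>p. poly p (x::'a::comm_ring_1))"
  by standard simp_all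

lemma cring_hom_map_poly:
  assumes "cring_hom \<phi>"
  shows "cring_hom (map_poly \<phi>)"
proof -
  interpret cring_hom \<phi> by fact
  have "map_poly \<phi> (p * q) = map_poly \<phi> p * map_poly \<phi> q" for p q
    by (rule poly_eqI) (simp add: coeff_map_poly hom_zero coeff_mult hom_sum hom_mult)
  moreover have "map_poly \<phi> (p + q) = map_poly \<phi> p + map_poly \<phi> q" for p q
    by (rule poly_eqI) (simp add: coeff_map_poly hom_zero hom_add)
  moreover have "map_poly \<phi> 1 = 1"
    by (rule poly_eqI) (simp add: coeff_map_poly hom_zero hom_one coeff_1)
  ultimately show ?thesis by unfold_locales
qed

text \<open>\<open>mpoly_subst\<close> is one instance. The free choice of the coefficient map and
  of the target ring also covers pencils of lines, points over the base field and real polynomial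
  functions.\<close>

definition mpoly_eval :: "('k::zero \<Rightarrow> 'r::comm_ring_1) \<Rightarrow> 'r^'n \<Rightarrow> ('n::finite, 'k) mpoly \<Rightarrow> 'r" where
  "mpoly_eval \<phi> x p = (\<Sum>m\<in>Poly_Mapping.keys p.
     \<phi> (Poly_Mapping.lookup p m) * (\<Prod>i\<in>UNIV. (x $ i) ^ Poly_Mapping.lookup m i))"

lemma mpoly_induct [case_names zero add]:
  fixes p :: "('n, 'k::comm_ring_1) mpoly"
  assumes zero: "P 0"
    and add: "\<And>m c q. P q \<Longrightarrow> P (Poly_Mapping.single m c + q)"
  shows "P p"
proof (induction p rule: update_induct)
  case const
  show ?case by (fact zero)
next
  case (update f a b)
  have "Poly_Mapping.update a b f = Poly_Mapping.single a b + f"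
    by (rule poly_mapping_eqI)
      (use update.hyps in \<open>auto simp: lookup_update lookup_add lookup_single in_keys_iff when_def\<close>)
  then show ?case using add[OF update.IH] by simp
qed

lemma cring_hom_mpoly_eval:
  fixes \<phi> :: "'k::comm_ring_1 \<Rightarrow> 'r::comm_ring_1" and x :: "'r^'n::finite"
  assumes "cring_hom \<phi>"
  shows "cring_hom (mpoly_eval \<phi> x)"
proof -
  interpret cring_hom \<phi> by fact
  have add: "mpoly_eval \<phi> x (p + q) = mpoly_eval \<phi> x p + mpoly_eval \<phi> x q" for p q
    unfolding mpoly_eval_def
    by (rule setsum_keys_plus_distrib) (simp_all add: hom_zero hom_add distrib_right)
  have single: "mpoly_eval \<phi> x (Poly_Mapping.single m c) =
      \<phi> c * (\<Prod>i\<in>UNIV. (x $ i) ^ Poly_Mapping.lookup m i)" for m c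
    by (simp add: mpoly_eval_def hom_zero)
  have zero: "mpoly_eval \<phi> x 0 = 0"
    by (simp add: mpoly_eval_def)
  have mult1: "mpoly_eval \<phi> x (Poly_Mapping.single m c * q) =
      mpoly_eval \<phi> x (Poly_Mapping.single m c) * mpoly_eval \<phi> x q" for m c q
  proof (induction q rule: mpoly_induct)
    case (add m' c' q)
    show ?case
      unfolding distrib_left assms add.IH \<open>\<And>q p. mpoly_eval \<phi> x (p + q) = _\<close> mult_single single
      by (simp add: hom_mult lookup_add power_add prod.distrib mult_ac)
  qed (simp add: zero)
  have mult: "mpoly_eval \<phi> x (p * q) = mpoly_eval \<phi> x p * mpoly_eval \<phi> x q" for p q
    by (induction p rule: mpoly_induct) (simp_all add: zero distrib_right add mult1)
  have one: "mpoly_eval \<phi> x 1 = 1"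
    unfolding single_one[symmetric] single by (simp add: hom_one)
  show ?thesis by unfold_locales (fact one add mult)+
qed

lemma mpoly_eval_const:
  assumes "cring_hom \<phi>"
  shows "mpoly_eval \<phi> x (mpoly_const c) = \<phi> c"
  using cring_hom.hom_zero[OF assms] by (simp add: mpoly_eval_def mpoly_const_def)

lemma mpoly_eval_var:
  fixes x :: "'r::comm_ring_1^'n::finite"
  assumes "cring_hom \<phi>"
  shows "mpoly_eval \<phi> x (mpoly_var i) = x $ i"
proof -
  have "(\<Prod>j\<in>UNIV. (x $ j) ^ Poly_Mapping.lookup (Poly_Mapping.single i 1) j) =
      (\<Prod>j\<in>UNIV. if j = i then x $ i else 1)"
    by (rule prod.cong) (auto simp: lookup_single when_def)
  then show ?thesis
    using cring_hom.hom_one[OF assms] by (simp add: mpoly_eval_def mpoly_var_def)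
qed

lemma hom_mpoly_eval:
  assumes "cring_hom \<psi>"
  shows "\<psi> (mpoly_eval \<phi> x p) = mpoly_eval (\<lambda>c. \<psi> (\<phi> c)) (map_vec \<psi> x) p"
proof -
  interpret cring_hom \<psi> by fact
  show ?thesis
    by (simp add: mpoly_eval_def hom_sum hom_mult hom_prod hom_power map_vec_def)
qed

lemma mpoly_eval_vars:
  "mpoly_eval mpoly_const (\<chi> i. mpoly_var i) p = (p :: ('n::finite, 'k::comm_ring_1) mpoly)"
proof -
  interpret e: cring_hom "mpoly_eval mpoly_const ((\<chi> i. mpoly_var i) :: (('n, 'k) mpoly)^'n)"
    by (intro cring_hom_mpoly_eval cring_hom_mpoly_const)
  have var_power: "mpoly_var i ^ k = (Poly_Mapping.single (Poly_Mapping.single i k) 1 :: ('n, 'k) mpoly)"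
    for i k
    by (induction k) (simp_all add: mpoly_var_def mult_single flip: single_add)
  have prod_single: "(\<Prod>i\<in>S. Poly_Mapping.single (h i) 1) = (Poly_Mapping.single (sum h S) 1 :: ('n, 'k) mpoly)"
    for S :: "'n set" and h
    by (induction S rule: infinite_finite_induct) (simp_all add: mult_single)
  have m: "(\<Sum>i\<in>UNIV. Poly_Mapping.single i (Poly_Mapping.lookup m i)) = m" for m :: "'n \<Rightarrow>\<^sub>0 nat"
    by (rule poly_mapping_eqI) (simp add: lookup_sum lookup_single when_def)
  have single: "mpoly_eval mpoly_const (\<chi> i. mpoly_var i) (Poly_Mapping.single m c) = Poly_Mapping.single m c"
    for m :: "'n \<Rightarrow>\<^sub>0 nat" and c :: 'k
  proof -
    have "(\<Prod>i\<in>UNIV. (mpoly_var i :: ('n, 'k) mpoly) ^ Poly_Mapping.lookup m i) = Poly_Mapping.single m 1"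
      unfolding var_power prod_single m ..
    then show ?thesis by (simp add: mpoly_eval_def mpoly_const_def mult_single)
  qed
  show ?thesis
    by (induction p rule: mpoly_induct) (simp_all add: e.hom_zero e.hom_add single)
qed

lemma mpoly_subst_eq_eval: "mpoly_subst f = mpoly_eval (\<lambda>c. Fract (mpoly_const c) 1) f"
  by (rule ext) (simp add: mpoly_subst_def mpoly_eval_def)

lemma cring_hom_Fract_const:
  "cring_hom (\<lambda>c::'k::field. Fract (mpoly_const c :: ('n::{finite,linorder}, 'k) mpoly) 1)"
  by (rule cring_hom_comp[OF cring_hom_mpoly_const cring_hom_Fract])

lemma cring_hom_mpoly_subst: "cring_hom (mpoly_subst f)"
  unfolding mpoly_subst_eq_eval by (intro cring_hom_mpoly_eval cring_hom_Fract_const)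

text \<open>
  The homogenisation of \<open>p\<close> in degree \<open>N\<close>, with \<open>d\<close> for the additional variable. Because of the
  truncated subtraction it requires \<open>N\<close> to be at least the total degree of \<open>p\<close>, for which
  \<open>mpoly_tdeg p\<close> is a crude upper bound.
\<close>

definition mpoly_heval ::
  "('k::zero \<Rightarrow> 'r::comm_ring_1) \<Rightarrow> nat \<Rightarrow> 'r \<Rightarrow> 'r^'n \<Rightarrow> ('n::finite, 'k) mpoly \<Rightarrow> 'r" where
  "mpoly_heval \<phi> N d x p = (\<Sum>m\<in>Poly_Mapping.keys p. \<phi> (Poly_Mapping.lookup p m) *
     (d ^ (N - sum (Poly_Mapping.lookup m) UNIV) * (\<Prod>i\<in>UNIV. (x $ i) ^ Poly_Mapping.lookup m i)))"

definition mpoly_tdeg :: "('n::finite, 'k::zero) mpoly \<Rightarrow> nat" where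
  "mpoly_tdeg p = (\<Sum>m\<in>Poly_Mapping.keys p. sum (Poly_Mapping.lookup m) UNIV)"

lemma mpoly_tdeg_ge: "m \<in> Poly_Mapping.keys p \<Longrightarrow> sum (Poly_Mapping.lookup m) UNIV \<le> mpoly_tdeg p"
  unfolding mpoly_tdeg_def by (rule member_le_sum) auto

lemma hom_mpoly_heval:
  assumes "cring_hom \<psi>"
  shows "\<psi> (mpoly_heval \<phi> N d x p) = mpoly_heval (\<lambda>c. \<psi> (\<phi> c)) N (\<psi> d) (map_vec \<psi> x) p"
proof -
  interpret cring_hom \<psi> by fact
  show ?thesis
    by (simp add: mpoly_heval_def hom_sum hom_mult hom_prod hom_power map_vec_def)
qed

lemma prod_smult_power:
  "(\<Prod>i\<in>UNIV. ((c *s x) $ i) ^ k i) = (c::'r::comm_ring_1) ^ sum k UNIV * (\<Prod>i\<in>UNIV. (x $ i) ^ k i)"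
  by (simp add: power_mult_distrib prod.distrib power_sum)

lemma mpoly_heval_scale:
  assumes "mpoly_tdeg p \<le> N"
  shows "mpoly_heval \<phi> N (c * d) (c *s x) p = c ^ N * mpoly_heval \<phi> N d x p"
  unfolding mpoly_heval_def sum_distrib_left
proof (rule sum.cong[OF refl])
  fix m assume "m \<in> Poly_Mapping.keys p"
  then have "c ^ N = c ^ (N - sum (Poly_Mapping.lookup m) UNIV) * c ^ sum (Poly_Mapping.lookup m) UNIV"
    using mpoly_tdeg_ge[of m p] assms by (simp flip: power_add)
  then show "\<phi> (Poly_Mapping.lookup p m) *
      ((c * d) ^ (N - sum (Poly_Mapping.lookup m) UNIV) * (\<Prod>i\<in>UNIV. (c *s x) $ i ^ Poly_Mapping.lookup m i)) =
    c ^ N * (\<phi> (Poly_Mapping.lookup p m) *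
      (d ^ (N - sum (Poly_Mapping.lookup m) UNIV) * (\<Prod>i\<in>UNIV. x $ i ^ Poly_Mapping.lookup m i)))"
    unfolding prod_smult_power power_mult_distrib by (simp only: mult_ac)
qed

lemma mpoly_heval_one: "mpoly_heval \<phi> N 1 x p = mpoly_eval \<phi> x p"
  by (simp add: mpoly_heval_def mpoly_eval_def)

lemma dvd_prod_diff:
  fixes f g :: "'i \<Rightarrow> 'r::comm_ring_1"
  assumes "\<And>i. i \<in> S \<Longrightarrow> D dvd f i - g i"
  shows "D dvd prod f S - prod g S"
  using assms
proof (induction S rule: infinite_finite_induct)
  case (insert i S)
  have "prod f (insert i S) - prod g (insert i S) =
      (f i - g i) * prod f S + g i * (prod f S - prod g S)"
    using insert.hyps by (simp add: algebra_simps)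
  then show ?case using insert by simp
qed simp_all

lemma dvd_power_diff:
  "(D::'r::comm_ring_1) dvd a - b \<Longrightarrow> D dvd a ^ k - b ^ k"
  using dvd_prod_diff[of "{..<k}" D "\<lambda>_. a" "\<lambda>_. b"] by simp

lemma mpoly_heval_cong_mod:
  fixes D :: "'r::comm_ring_1"
  assumes "\<And>i. D dvd x $ i - y $ i"
  shows "D dvd mpoly_heval \<phi> N d x p - mpoly_heval \<phi> N d y p"
  unfolding mpoly_heval_def sum_subtractf[symmetric] right_diff_distrib[symmetric]
  by (intro dvd_sum dvd_mult dvd_prod_diff dvd_power_diff assms)

section \<open>Cofactors of a row\<close>

definition dot :: "'a::comm_ring_1^'n \<Rightarrow> 'a^'n \<Rightarrow> 'a" where
  "dot u v = (\<Sum>i\<in>UNIV. u $ i * v $ i)"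

definition row_subst :: "'n \<Rightarrow> 'a^'n \<Rightarrow> 'a^'n^'n \<Rightarrow> 'a^'n^'n" where
  "row_subst r v X = (\<chi> i. if i = r then v else X $ i)"

text \<open>The generalised cross product of the rows other than \<open>r\<close>: its entries are
  signed minors, and it does not depend on row \<open>r\<close> of \<open>X\<close>.\<close>

definition row_cofactor :: "'n \<Rightarrow> 'a::comm_ring_1^'n^'n \<Rightarrow> 'a^'n" where
  "row_cofactor r X = (\<chi> j. det (row_subst r (axis j 1) X))"

lemma det_row_subst: "det (row_subst r v X) = dot v (row_cofactor r X)"
proof -
  have "det (row_subst r v X) = det (\<chi> i. if i = r then \<Sum>j\<in>UNIV. v $ j *s axis j 1 else X $ i)"
    unfolding row_subst_def basis_expansion ..
  also have "\<dots> = (\<Sum>j\<in>UNIV. v $ j * det (\<chi> i. if i = r then axis j 1 else X $ i))"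
    by (simp add: det_linear_row_sum det_row_mul)
  finally show ?thesis by (simp add: dot_def row_cofactor_def row_subst_def)
qed

lemma dot_row_cofactor:
  assumes "i \<noteq> r"
  shows "dot (X $ i) (row_cofactor r X) = 0"
  unfolding det_row_subst[symmetric]
  by (rule det_identical_rows[OF assms]) (use assms in \<open>simp add: row_def row_subst_def\<close>)

lemma det_zero_col:
  fixes X :: "'a::comm_ring_1^'n^'n"
  assumes "\<And>i. X $ i $ k = 0"
  shows "det X = 0"
proof -
  have "(\<Prod>i\<in>UNIV. X $ i $ p i) = 0" if "p permutes UNIV" for p
  proof (rule prod_zero[OF finite])
    show "\<exists>i\<in>UNIV. X $ i $ p i = 0"
      using assms permutes_surj[OF that] by (metis UNIV_I surjD)
  qed
  then show ?thesis by (simp add: det_def)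
qed

text \<open>Cramer's rule without division, as needed over polynomial rings. In the expansion of the
  substituted row, each summand with \<open>l \<noteq> k\<close> repeats a row.\<close>

lemma cramer_rows_cring:
  fixes X :: "'a::comm_ring_1^'n^'n"
  shows "det (row_subst k (\<Sum>l\<in>UNIV. v $ l *s X $ l) X) = v $ k * det X"
proof -
  have "det (row_subst k (X $ l) X) = (if l = k then det X else 0)" for l
  proof (cases "l = k")
    case True
    then have "row_subst k (X $ l) X = X" by (simp add: row_subst_def vec_eq_iff)
    with True show ?thesis by simp
  next
    case False
    then show ?thesis
      by (simp add: det_row_subst dot_row_cofactor)
  qed
  then have "(\<Sum>l\<in>UNIV. v $ l * det (row_subst k (X $ l) X)) = (\<Sum>l\<in>UNIV. if l = k then v $ k * det X else 0)"
    by (intro sum.cong) auto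
  then show ?thesis
    by (simp add: row_subst_def det_linear_row_sum det_row_mul)
qed

lemma cramer_cring:
  fixes X :: "'a::comm_ring_1^'n^'n"
  shows "det (\<chi> i j. if j = k then (X *v v) $ i else X $ i $ j) = v $ k * det X"
proof -
  have "(\<chi> i j. if j = k then (X *v v) $ i else X $ i $ j) =
      transpose (row_subst k (\<Sum>l\<in>UNIV. v $ l *s transpose X $ l) (transpose X))"
    by (simp add: vec_eq_iff transpose_def row_subst_def matrix_vector_mult_def mult.commute)
  then show ?thesis
    by (simp only: det_transpose cramer_rows_cring)
qed

lemma det_eq_0_kernel:
  fixes X :: "'a::idom^'n^'n"
  assumes "X *v v = 0" "v \<noteq> 0"
  shows "det X = 0"
proof -
  obtain k where k: "v $ k \<noteq> 0" using assms(2) by (auto simp: vec_eq_iff)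
  have "v $ k * det X = 0"
    unfolding cramer_cring[symmetric] by (rule det_zero_col[where k = k]) (simp add: assms(1))
  with k show ?thesis by simp
qed

text \<open>The vector \<open>v $ j *s axis k 1 - v $ k *s axis j 1\<close> is orthogonal to
  \<open>v\<close>. Put in place of row \<open>r\<close>, it gives a matrix that kills
  \<open>v\<close>; the determinant of that matrix is the difference of the two sides.\<close>

lemma row_cofactor_proportional:
  fixes X :: "'a::idom^'n^'n"
  assumes "\<And>i. i \<noteq> r \<Longrightarrow> dot (X $ i) v = 0"
  shows "v $ j * row_cofactor r X $ k = v $ k * row_cofactor r X $ j"
proof (cases "v = 0")
  case False
  let ?a = "v $ j *s axis k 1 - v $ k *s axis j 1 :: 'a^'n"
  have dot_axis: "dot (axis l 1) x = x $ l" for l and x :: "'a^'n"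
  proof -
    have "dot (axis l 1) x = (\<Sum>i\<in>UNIV. if i = l then x $ i else 0)"
      unfolding dot_def by (rule sum.cong) (auto simp: axis_def)
    then show ?thesis by simp
  qed
  have a: "dot ?a x = v $ j * x $ k - v $ k * x $ j" for x
  proof -
    have "dot ?a x = v $ j * dot (axis k 1) x - v $ k * dot (axis j 1) x"
      by (simp add: dot_def left_diff_distrib sum_subtractf sum_distrib_left mult.assoc)
    then show ?thesis by (simp only: dot_axis)
  qed
  have "(row_subst r ?a X *v v) $ i = 0" for i
  proof -
    have "(row_subst r ?a X *v v) $ i = dot (row_subst r ?a X $ i) v"
      by (simp add: matrix_vector_mult_def dot_def)
    also have "\<dots> = 0"
      using assms[of i] a[of v] by (cases "i = r") (simp_all add: row_subst_def mult.commute)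
    finally show ?thesis .
  qed
  then have "det (row_subst r ?a X) = 0"
    using False by (intro det_eq_0_kernel) (auto simp: vec_eq_iff)
  then show ?thesis by (simp add: det_row_subst a)
qed simp

lemma det_add_row:
  fixes X :: "'a::comm_ring_1^'n^'n"
  assumes "r \<notin> S"
  shows "det (\<chi> i. if i \<in> S then X $ i + X $ r else X $ i) = det X"
proof -
  have "finite S" by simp
  then show ?thesis using assms
  proof (induction S)
    case empty
    then show ?case by simp
  next
    case (insert k S)
    let ?Y = "\<chi> i. if i \<in> S then X $ i + X $ r else X $ i"
    have "(\<chi> i. if i \<in> insert k S then X $ i + X $ r else X $ i) =
        (\<chi> i. if i = k then row k ?Y + 1 *s row r ?Y else row i ?Y)"
      using insert by (auto simp: vec_eq_iff row_def)
    also have "det \<dots> = det ?Y"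
      by (rule det_row_operation) (use insert in auto)
    finally show ?case using insert by simp
  qed
qed

lemma det_scale_rows_cols:
  fixes X :: "'a::comm_ring_1^'n^'n"
  shows "det (\<chi> i j. r i * c j * X $ i $ j) = prod r UNIV * prod c UNIV * det X"
proof -
  have "(\<Prod>i\<in>UNIV. r i * c (p i) * X $ i $ p i) = prod r UNIV * prod c UNIV * (\<Prod>i\<in>UNIV. X $ i $ p i)"
    if "p permutes UNIV" for p
    using prod.permute[OF that, of c] by (simp add: prod.distrib o_def mult_ac)
  then show ?thesis
    unfolding det_def sum_distrib_left by (intro sum.cong) (auto simp: mult_ac)
qed

section \<open>The surface and its parametrisation\<close>

lemma exhaust_6: "(x::6) = 1 \<or> x = 2 \<or> x = 3 \<or> x = 4 \<or> x = 5 \<or> x = 6"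
proof (induct x)
  case (of_int z)
  then have "z = 0 \<or> z = 1 \<or> z = 2 \<or> z = 3 \<or> z = 4 \<or> z = 5" by fastforce
  then show ?case by auto
qed

lemma forall_6: "(\<forall>i::6. P i) \<longleftrightarrow> P 1 \<and> P 2 \<and> P 3 \<and> P 4 \<and> P 5 \<and> P 6"
  by (metis exhaust_6)

lemma UNIV_6: "UNIV = {1, 2, 3, 4, 5, 6::6}"
  using exhaust_6 by auto

lemma sum_6: "sum f (UNIV::6 set) = f 1 + f 2 + f 3 + f 4 + f 5 + f 6"
  unfolding UNIV_6 by (simp add: ac_simps)

lemma vector_6 [simp]:
  "(vector [a, b, c, d, e, f] :: 'a::zero^6) $ 1 = a"
  "(vector [a, b, c, d, e, f] :: 'a::zero^6) $ 2 = b"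
  "(vector [a, b, c, d, e, f] :: 'a::zero^6) $ 3 = c"
  "(vector [a, b, c, d, e, f] :: 'a::zero^6) $ 4 = d"
  "(vector [a, b, c, d, e, f] :: 'a::zero^6) $ 5 = e"
  "(vector [a, b, c, d, e, f] :: 'a::zero^6) $ 6 = f"
  unfolding vector_def by simp_all

section \<open>Vectors of length six as pairs of vectors of length three\<close>

lemma dot_3: "dot u v = u $ 1 * v $ 1 + u $ 2 * v $ 2 + u $ 3 * v $ (3::3)"
  by (simp add: dot_def sum_3)

lemma cross_nth [simp]:
  "cross v w $ 1 = v $ 2 * w $ 3 - v $ 3 * w $ 2"
  "cross v w $ 2 = v $ 3 * w $ 1 - v $ 1 * w $ 3"
  "cross v w $ 3 = v $ 1 * w $ 2 - v $ 2 * w $ 1"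
  by (simp_all add: cross_def)

definition join :: "'a::zero^3 \<Rightarrow> 'a^3 \<Rightarrow> 'a^6" where
  "join u s = vector [u $ 1, u $ 2, u $ 3, s $ 1, s $ 2, s $ 3]"

definition upper :: "'a::zero^6 \<Rightarrow> 'a^3" where
  "upper v = vector [v $ 1, v $ 2, v $ 3]"

definition lower :: "'a::zero^6 \<Rightarrow> 'a^3" where
  "lower v = vector [v $ 4, v $ 5, v $ 6]"

lemma join_nth [simp]:
  "join u s $ 1 = u $ 1" "join u s $ 2 = u $ 2" "join u s $ 3 = u $ 3"
  "join u s $ 4 = s $ 1" "join u s $ 5 = s $ 2" "join u s $ 6 = s $ 3"
  by (simp_all add: join_def)

lemma upper_nth [simp]: "upper v $ 1 = v $ 1" "upper v $ 2 = v $ 2" "upper v $ 3 = v $ 3"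
  by (simp_all add: upper_def)

lemma lower_nth [simp]: "lower v $ 1 = v $ 4" "lower v $ 2 = v $ 5" "lower v $ 3 = v $ 6"
  by (simp_all add: lower_def)

lemma dot_join: "dot (join u s) v = dot u (upper v) + dot s (lower v)"
  by (simp add: dot_def sum_6 sum_3 algebra_simps)

lemma upper_join [simp]: "upper (join u s) = u" and lower_join [simp]: "lower (join u s) = s"
  by (simp_all add: vec_eq_iff forall_3)

definition leg_matrix :: "'a::comm_ring_1^3^6 \<Rightarrow> 'a^3^6 \<Rightarrow> 'a^3 \<Rightarrow> 'a^6^6" where
  "leg_matrix A C P = (\<chi> i. join (C $ i) (cross (A $ i) (C $ i + P)))"

text \<open>The motion \<open>join u w\<close> that is orthogonal to the differences of rows 2 to 6
  of the Jacobian with its first row \<open>join P 0\<close>. It is defined at every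
  \<open>P\<close>; the first leg adds the condition \<open>dot P u = 0\<close>, whose left side is
  \<open>platform_det\<close>.\<close>

definition twist :: "'a::comm_ring_1^3^6 \<Rightarrow> 'a^3^6 \<Rightarrow> 'a^3 \<Rightarrow> 'a^6" where
  "twist A C P = row_cofactor 1 (leg_matrix A C P)"

definition platform_det :: "'a::comm_ring_1^3^6 \<Rightarrow> 'a^3^6 \<Rightarrow> 'a^3 \<Rightarrow> 'a" where
  "platform_det A C P = dot P (upper (twist A C P))"

text \<open>The coefficient vector of \<open>vel_den\<close>, which is linear in \<open>w\<close>; a
  single cofactor computation thus serves all directions.\<close>

definition pole :: "'a::comm_ring_1^3^6 \<Rightarrow> 'a^3^6 \<Rightarrow> 'a^3" where
  "pole A C = lower (row_cofactor 1 (\<chi> i. join (C $ i) (A $ i)))"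

text \<open>
  A motion of the platform with angular velocity \<open>w\<close> that keeps all leg lengths has \<open>u\<close> with
  \<open>C\<^sub>i \<bullet> u + A\<^sub>i \<bullet> s = - w \<bullet> (A\<^sub>i \<times> C\<^sub>i)\<close> for \<open>i = 2, \<dots>, 6\<close>, where \<open>s = P \<times> w\<close> and hence \<open>w \<bullet> s = 0\<close>.
  This is a linear system for \<open>(u, s)\<close> whose solution by Cramer's rule is quadratic in \<open>w\<close>; as
  moreover \<open>P \<bullet> u = 0\<close>, it determines \<open>P\<close> by \<open>u \<times> s = (u \<bullet> w) P\<close>.
\<close>

definition vel_matrix :: "'a::comm_ring_1^3^6 \<Rightarrow> 'a^3^6 \<Rightarrow> 'a^3 \<Rightarrow> 'a^6^6" where
  "vel_matrix A C w = row_subst 1 (join 0 w) (\<chi> i. join (C $ i) (A $ i))"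

definition vel_rhs :: "'a::comm_ring_1^3^6 \<Rightarrow> 'a^3^6 \<Rightarrow> 'a^3 \<Rightarrow> 'a^6" where
  "vel_rhs A C w = (\<chi> i. if i = 1 then 0 else - dot w (cross (A $ i) (C $ i)))"

definition vel_den :: "'a::comm_ring_1^3^6 \<Rightarrow> 'a^3^6 \<Rightarrow> 'a^3 \<Rightarrow> 'a" where
  "vel_den A C w = det (vel_matrix A C w)"

definition vel_num :: "'a::comm_ring_1^3^6 \<Rightarrow> 'a^3^6 \<Rightarrow> 'a^3 \<Rightarrow> 'a^6" where
  "vel_num A C w = (\<chi> k. det (\<chi> i j. if j = k then vel_rhs A C w $ i else vel_matrix A C w $ i $ j))"

definition par_num :: "'a::comm_ring_1^3^6 \<Rightarrow> 'a^3^6 \<Rightarrow> 'a^3 \<Rightarrow> 'a^3" where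
  "par_num A C w = cross (upper (vel_num A C w)) (lower (vel_num A C w))"

definition par_den :: "'a::comm_ring_1^3^6 \<Rightarrow> 'a^3^6 \<Rightarrow> 'a^3 \<Rightarrow> 'a" where
  "par_den A C w = vel_den A C w * dot (upper (vel_num A C w)) w"

lemma platform_det_eq: "platform_det A C P = det (row_subst 1 (join P 0) (leg_matrix A C P))"
  by (simp add: platform_det_def det_row_subst dot_join twist_def) (simp add: dot_def)

lemma det_legs_eq_platform_det:
  assumes "A $ 1 = 0" "C $ 1 = 0"
  shows "det (\<chi> i. join (C $ i + P) (cross (A $ i) (C $ i + P))) = platform_det A C P"
proof -
  let ?X = "row_subst 1 (join P 0) (leg_matrix A C P)"
  have "(\<chi> i. join (C $ i + P) (cross (A $ i) (C $ i + P))) =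
      (\<chi> i. if i \<in> - {1} then ?X $ i + ?X $ 1 else ?X $ i)"
    unfolding vec_eq_iff forall_6
    by (simp add: row_subst_def leg_matrix_def join_def assms)
  then show ?thesis
    using det_add_row[of 1 "- {1}" ?X] by (simp add: platform_det_eq)
qed

lemma vel_den_eq: "vel_den A C w = dot w (pole A C)"
  by (simp add: vel_den_def vel_matrix_def det_row_subst dot_join pole_def) (simp add: dot_def)

lemma leg_twist:
  assumes "i \<noteq> 1"
  shows "dot (C $ i) (upper (twist A C P)) + dot (cross (A $ i) (C $ i + P)) (lower (twist A C P)) = 0"
  using dot_row_cofactor[OF assms, of "leg_matrix A C P"]
  by (simp add: twist_def leg_matrix_def dot_join)

lemma vel_matrix_mult:
  "(vel_matrix A C w *v v) $ i =
    (if i = 1 then dot w (lower v) else dot (C $ i) (upper v) + dot (A $ i) (lower v))"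
proof -
  have "(vel_matrix A C w *v v) $ i = dot (vel_matrix A C w $ i) v"
    by (simp add: matrix_vector_mult_def dot_def)
  then show ?thesis
    by (simp add: vel_matrix_def row_subst_def dot_join dot_3)
qed

lemma vel_num_eqI:
  assumes "vel_matrix A C w *v v = vel_rhs A C w"
  shows "vel_num A C w = vel_den A C w *s v"
  using cramer_cring[of _ "vel_matrix A C w" v, unfolded assms]
  by (simp add: vec_eq_iff vel_num_def vel_den_def mult.commute)

text \<open>This holds off the surface too. The equations of legs 2 to 6 are
  \<open>leg_twist\<close>, the remaining one is \<open>dot w (cross P w) = 0\<close>, and the
  condition of the first leg does not occur in the system.\<close>

lemma vel_num_twist:
  fixes A C :: "'a::comm_ring_1^3^6" and P :: "'a^3"
  defines "w \<equiv> lower (twist A C P)"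
  shows "vel_num A C w = vel_den A C w *s join (upper (twist A C P)) (cross P w)"
proof (rule vel_num_eqI, unfold vec_eq_iff, rule allI)
  fix i
  show "(vel_matrix A C w *v join (upper (twist A C P)) (cross P w)) $ i = vel_rhs A C w $ i"
    using leg_twist[of i C A P]
    unfolding vel_matrix_mult vel_rhs_def w_def
    by (cases "i = 1") (simp_all add: dot_3 algebra_simps add_eq_0_iff)
qed

text \<open>The \<open>h\<close> of the overview, in a form that can be evaluated at a point from a
  kernel vector and the pole alone.\<close>

definition par_den_twist :: "'a::comm_ring_1^3^6 \<Rightarrow> 'a^3^6 \<Rightarrow> 'a^3 \<Rightarrow> 'a" where
  "par_den_twist A C P =
    vel_den A C (lower (twist A C P)) ^ 2 * dot (upper (twist A C P)) (lower (twist A C P))"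

lemma par_den_lower_twist: "par_den A C (lower (twist A C P)) = par_den_twist A C P"
  unfolding par_den_def par_den_twist_def vel_num_twist
  by (simp add: dot_3 power2_eq_square algebra_simps)

text \<open>The rule \<open>u x (P x w) = (u . w) P - (u . P) w\<close>, in which
  \<open>u . P\<close> is the determinant. Modulo the determinant, passing from \<open>P\<close> to
  the angular velocity and back returns \<open>P\<close> up to the factor \<open>h\<close>.\<close>

lemma par_num_lower_twist:
  "par_num A C (lower (twist A C P)) = par_den_twist A C P *s P -
    (vel_den A C (lower (twist A C P)) ^ 2 * platform_det A C P) *s lower (twist A C P)"
  unfolding par_num_def par_den_twist_def vel_num_twist vec_eq_iff forall_3 platform_det_def
  by (simp add: dot_3 power2_eq_square algebra_simps)

lemma vel_den_scale: "vel_den A C (c *s w) = c * vel_den A C w"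
  by (simp add: vel_den_eq dot_3 algebra_simps)

text \<open>Both row 1 of the matrix and the replaced column are linear in \<open>w\<close>, and the
  entry where they meet is 0.\<close>

lemma vel_num_scale: "vel_num A C (c *s w) = c\<^sup>2 *s vel_num A C w"
proof -
  have "vel_num A C (c *s w) $ k = c\<^sup>2 * vel_num A C w $ k" for k
  proof -
    let ?X = "\<chi> i j. if j = k then vel_rhs A C w $ i else vel_matrix A C w $ i $ j"
    let ?f = "\<lambda>i. if i = (1::6) then c else 1" and ?g = "\<lambda>j. if j = k then c else 1"
    have s: "join 0 (c *s w) = c *s join 0 w"
      by (simp add: vec_eq_iff forall_6)
    have "vel_num A C (c *s w) $ k = det (\<chi> i j. ?f i * ?g j * ?X $ i $ j)"
      unfolding vel_num_def vec_lambda_beta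
      by (rule arg_cong[where f = det])
        (simp add: vec_eq_iff vel_rhs_def vel_matrix_def row_subst_def s, simp add: dot_3 algebra_simps)
    also have "\<dots> = prod ?f UNIV * prod ?g UNIV * det ?X"
      by (rule det_scale_rows_cols)
    finally show ?thesis
      by (simp add: vel_num_def power2_eq_square)
  qed
  then show ?thesis by (simp add: vec_eq_iff)
qed

lemma par_den_scale: "par_den A C (c *s w) = c ^ 4 * par_den A C w"
  by (simp add: par_den_def vel_num_scale vel_den_scale dot_3 algebra_simps power2_eq_square
      power4_eq_xxxx)

lemma par_num_scale: "par_num A C (c *s w) = c ^ 4 *s par_num A C w"
  by (simp add: par_num_def vel_num_scale vec_eq_iff forall_3 algebra_simps power2_eq_square
      power4_eq_xxxx)

text \<open>
  Conversely, every \<open>w\<close> is the angular velocity of an infinitesimal motion of the platform at the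
  position that it parametrises.
\<close>

lemma twist_at_parameter:
  fixes A C :: "'a::field^3^6" and w :: "'a^3"
  assumes den: "par_den A C w \<noteq> 0"
  defines "P \<equiv> (\<chi> i. par_num A C w $ i / par_den A C w)"
  shows "w $ j * lower (twist A C P) $ k = w $ k * lower (twist A C P) $ j"
    and "w $ k \<noteq> 0 \<Longrightarrow> platform_det A C P = 0"
proof -
  let ?d = "vel_den A C w"
  define v where "v = (\<chi> k. vel_num A C w $ k / ?d)"
  define u s where "u = upper v" and "s = lower v"
  have d: "?d \<noteq> 0" using den by (auto simp: par_den_def)
  have "vel_matrix A C w *v v = vel_rhs A C w"
    using cramer[of "vel_matrix A C w" v] d by (simp add: v_def vel_num_def vel_den_def)
  then have eqs: "(if i = 1 then dot w s else dot (C $ i) u + dot (A $ i) s) = vel_rhs A C w $ i" for i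
    unfolding u_def s_def vel_matrix_mult[symmetric] by simp
  have ws: "dot w s = 0" using eqs[of 1] by (simp add: vel_rhs_def)
  have num: "vel_num A C w = ?d *s v" using d by (simp add: v_def vec_eq_iff)
  then have num_u: "upper (vel_num A C w) = ?d *s u" and num_s: "lower (vel_num A C w) = ?d *s s"
    by (simp_all add: u_def s_def vec_eq_iff forall_3)
  have par_den: "par_den A C w = ?d\<^sup>2 * dot u w"
    by (simp add: par_den_def num_u dot_3 power2_eq_square algebra_simps)
  with den have uw: "dot u w \<noteq> 0" by auto
  have P: "P $ i = cross u s $ i / dot u w" for i
  proof -
    have "par_num A C w = ?d\<^sup>2 *s cross u s"
      by (simp add: par_num_def num_u num_s vec_eq_iff forall_3 power2_eq_square algebra_simps)
    then show ?thesis using d uw by (simp add: P_def par_den)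
  qed
  have uwP: "dot u w * P $ i = cross u s $ i" for i
    using uw by (simp add: P)
  have Pu: "dot u P = 0"
  proof -
    have "dot u w * dot u P = dot u (\<chi> i. dot u w * P $ i)"
      by (simp add: dot_3[of u P] dot_3[of u "vec_lambda _"] distrib_left mult.left_commute)
    also have "\<dots> = 0" unfolding uwP by (simp add: dot_3 algebra_simps)
    finally show ?thesis using uw by simp
  qed
  have Pw: "cross P w = s"
  proof -
    have "dot u w *s cross P w = cross (\<chi> i. dot u w * P $ i) w"
      by (simp add: vec_eq_iff forall_3 algebra_simps)
    also have "\<dots> = cross (cross u s) w"
      by (simp add: uwP vec_eq_iff forall_3)
    also have "\<dots> = dot u w *s s - dot w s *s u"
      by (simp add: vec_eq_iff forall_3 dot_3 algebra_simps)
    finally have "dot u w *s cross P w = dot u w *s s" by (simp add: ws)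
    then show ?thesis using uw by (simp add: vec_eq_iff)
  qed
  have orth: "dot (leg_matrix A C P $ i) (join u w) = 0" if "i \<noteq> 1" for i
  proof -
    have "dot (C $ i) u + dot (A $ i) (cross P w) = - dot w (cross (A $ i) (C $ i))"
      using eqs[of i] that by (simp add: vel_rhs_def Pw)
    then show ?thesis
      by (simp add: leg_matrix_def dot_join) (simp add: dot_3 algebra_simps add_eq_0_iff)
  qed
  have proportional: "join u w $ j * twist A C P $ k = join u w $ k * twist A C P $ j" for j k
    unfolding twist_def by (rule row_cofactor_proportional) (fact orth)
  have "\<forall>j k. w $ j * lower (twist A C P) $ k = w $ k * lower (twist A C P) $ j"
    using proportional[of 4 5] proportional[of 4 6] proportional[of 5 6]
    unfolding forall_3 by simp
  then show "w $ j * lower (twist A C P) $ k = w $ k * lower (twist A C P) $ j" by blast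
  assume wk: "w $ k \<noteq> 0"
  \<comment> \<open>The two halves of the twist have the same ratio to \<open>u\<close> and
    \<open>w\<close>, so \<open>dot u P = 0\<close> carries over to the determinant. The twist
    itself may vanish here.\<close>
  have "\<forall>j k. w $ k * upper (twist A C P) $ j = u $ j * lower (twist A C P) $ k"
    using proportional[of 4 1] proportional[of 4 2] proportional[of 4 3]
      proportional[of 5 1] proportional[of 5 2] proportional[of 5 3]
      proportional[of 6 1] proportional[of 6 2] proportional[of 6 3]
    unfolding forall_3 by simp
  then have wu: "w $ k * upper (twist A C P) $ j = u $ j * lower (twist A C P) $ k" for j by blast
  have "w $ k * platform_det A C P = dot P (\<chi> j. w $ k * upper (twist A C P) $ j)"
    unfolding platform_det_def
    by (simp only: dot_3 vec_lambda_beta distrib_left mult.left_commute)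
  also have "\<dots> = lower (twist A C P) $ k * dot u P"
    unfolding wu by (simp add: dot_3 algebra_simps)
  finally have "w $ k * platform_det A C P = lower (twist A C P) $ k * dot u P" .
  with Pu wk show "platform_det A C P = 0" by simp
qed

section \<open>Compatibility of the constructions with ring homomorphisms\<close>

context cring_hom
begin

lemma hom_dot: "\<phi> (dot u v) = dot (map_vec \<phi> u) (map_vec \<phi> v)"
  by (simp add: dot_def map_vec_def hom_sum hom_mult)

lemma map_vec_smult: "map_vec \<phi> (c *s v) = \<phi> c *s map_vec \<phi> v"
  by (simp add: map_vec_def vec_eq_iff hom_mult)

lemma map_vec_row_cofactor:
  "map_vec \<phi> (row_cofactor r X) = row_cofactor r (map_vec (map_vec \<phi>) X)"
proof -
  have "\<phi> (det (row_subst r (axis j 1) X)) = det (row_subst r (axis j 1) (map_vec (map_vec \<phi>) X))" for j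
    unfolding hom_det
    by (rule arg_cong[where f = det])
      (simp add: map_vec_def row_subst_def vec_eq_iff axis_def hom_zero hom_one)
  then show ?thesis
    by (simp add: row_cofactor_def) (simp add: map_vec_def)
qed

lemma map_vec_cross: "map_vec \<phi> (cross u v) = cross (map_vec \<phi> u) (map_vec \<phi> v)"
  by (simp add: vec_eq_iff forall_3 map_vec_def hom_diff hom_mult)

lemma map_vec_join: "map_vec \<phi> (join u v) = join (map_vec \<phi> u) (map_vec \<phi> v)"
  by (simp add: vec_eq_iff forall_6 map_vec_def)

lemma map_vec_upper: "map_vec \<phi> (upper v) = upper (map_vec \<phi> v)"
  and map_vec_lower: "map_vec \<phi> (lower v) = lower (map_vec \<phi> v)"
  by (simp_all add: vec_eq_iff forall_3 map_vec_def)

lemma map_vec_add: "map_vec \<phi> (u + v) = map_vec \<phi> u + map_vec \<phi> v"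
  by (simp add: map_vec_def vec_eq_iff hom_add)

lemma map_vec_lambda: "map_vec \<psi> (\<chi> i. f i) = (\<chi> i. \<psi> (f i))"
  by (simp add: map_vec_def)

lemma map_vec_twist:
  "map_vec \<phi> (twist A C P) = twist (map_vec (map_vec \<phi>) A) (map_vec (map_vec \<phi>) C) (map_vec \<phi> P)"
  by (simp add: twist_def map_vec_row_cofactor leg_matrix_def map_vec_lambda map_vec_join
      map_vec_cross map_vec_add) (simp add: map_vec_def)

lemma hom_platform_det:
  "\<phi> (platform_det A C P) =
    platform_det (map_vec (map_vec \<phi>) A) (map_vec (map_vec \<phi>) C) (map_vec \<phi> P)"
  by (simp add: platform_det_def hom_dot map_vec_upper map_vec_twist)

lemma map_vec_pole:
  "map_vec \<phi> (pole A C) = pole (map_vec (map_vec \<phi>) A) (map_vec (map_vec \<phi>) C)"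
  by (simp add: pole_def map_vec_row_cofactor map_vec_lower map_vec_lambda map_vec_join)
    (simp add: map_vec_def)

lemma hom_vel_den:
  "\<phi> (vel_den A C w) = vel_den (map_vec (map_vec \<phi>) A) (map_vec (map_vec \<phi>) C) (map_vec \<phi> w)"
  by (simp add: vel_den_eq hom_dot map_vec_pole)

lemma map_vec_zero: "map_vec \<phi> 0 = 0"
  by (simp add: map_vec_def vec_eq_iff hom_zero)

lemma map_vec_vel_num:
  "map_vec \<phi> (vel_num A C w) =
    vel_num (map_vec (map_vec \<phi>) A) (map_vec (map_vec \<phi>) C) (map_vec \<phi> w)"
proof -
  let ?A = "map_vec (map_vec \<phi>) A" and ?C = "map_vec (map_vec \<phi>) C" and ?w = "map_vec \<phi> w"
  have rhs: "\<phi> (vel_rhs A C w $ i) = vel_rhs ?A ?C ?w $ i" for i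
    by (simp add: vel_rhs_def hom_zero hom_minus hom_dot map_vec_cross) (simp add: map_vec_def)
  have "map_vec \<phi> (vel_matrix A C w $ i) = vel_matrix ?A ?C ?w $ i" for i
    by (simp add: vel_matrix_def row_subst_def map_vec_join map_vec_zero) (simp add: map_vec_def)
  then have mat: "\<phi> (vel_matrix A C w $ i $ j) = vel_matrix ?A ?C ?w $ i $ j" for i j
    by (simp add: map_vec_def vec_eq_iff)
  show ?thesis
    by (simp add: vel_num_def map_vec_lambda hom_det if_distrib[of \<phi>] rhs mat cong: if_cong)
qed

lemma hom_par_den:
  "\<phi> (par_den A C w) = par_den (map_vec (map_vec \<phi>) A) (map_vec (map_vec \<phi>) C) (map_vec \<phi> w)"
  by (simp add: par_den_def hom_mult hom_dot hom_vel_den map_vec_upper map_vec_vel_num)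

lemma map_vec_par_num:
  "map_vec \<phi> (par_num A C w) =
    par_num (map_vec (map_vec \<phi>) A) (map_vec (map_vec \<phi>) C) (map_vec \<phi> w)"
  by (simp add: par_num_def map_vec_cross map_vec_upper map_vec_lower map_vec_vel_num)

lemma hom_par_den_twist:
  "\<phi> (par_den_twist A C P) =
    par_den_twist (map_vec (map_vec \<phi>) A) (map_vec (map_vec \<phi>) C) (map_vec \<phi> P)"
  by (simp add: hom_par_den map_vec_lower map_vec_twist flip: par_den_lower_twist)

end

section \<open>Polynomials on a pencil of lines\<close>

definition bideg_le :: "nat \<Rightarrow> 'a::comm_ring_1 poly poly \<Rightarrow> bool" where
  "bideg_le n F \<longleftrightarrow> (\<forall>i j. coeff (coeff F i) j \<noteq> 0 \<longrightarrow> i + j \<le> n)"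

lemma bideg_leD: "bideg_le n F \<Longrightarrow> n < i + j \<Longrightarrow> coeff (coeff F i) j = 0"
  by (metis bideg_le_def not_less)

lemma bideg_le_0 [simp]: "bideg_le n 0"
  by (simp add: bideg_le_def)

lemma bideg_le_const: "bideg_le n [:[:a:]:]"
  by (auto simp: bideg_le_def coeff_pCons split: nat.splits)

lemma bideg_le_add: "bideg_le n F \<Longrightarrow> bideg_le n G \<Longrightarrow> bideg_le n (F + G)"
  unfolding bideg_le_def coeff_add by (metis add.left_neutral)

lemma bideg_le_diff: "bideg_le n F \<Longrightarrow> bideg_le n G \<Longrightarrow> bideg_le n (F - G)"
  unfolding bideg_le_def coeff_diff by (metis diff_zero)

lemma bideg_le_mult:
  assumes "bideg_le m F" "bideg_le n G"
  shows "bideg_le (m + n) (F * G)"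
proof -
  have "coeff (coeff (F * G) i) j = 0" if "m + n < i + j" for i j
    unfolding coeff_mult coeff_sum
  proof (intro sum.neutral ballI)
    fix k l assume "k \<in> {..i}" "l \<in> {..j}"
    with that have "m < k + l \<or> n < (i - k) + (j - l)" by auto
    then show "coeff (coeff F k) l * coeff (coeff G (i - k)) (j - l) = 0"
      using assms by (auto simp: bideg_leD)
  qed
  then show ?thesis
    by (meson bideg_le_def not_less)
qed

lemma bideg_le_const_mult: "bideg_le n F \<Longrightarrow> bideg_le n ([:[:a:]:] * F)"
  using bideg_le_mult[OF bideg_le_const[of 0]] by fastforce

lemma bideg_le_sum: "(\<And>x. x \<in> S \<Longrightarrow> bideg_le n (f x)) \<Longrightarrow> bideg_le n (sum f S)"
  by (induction S rule: infinite_finite_induct) (auto intro: bideg_le_add)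

lemma bideg_le_prod: "(\<And>x. x \<in> S \<Longrightarrow> bideg_le (n x) (f x)) \<Longrightarrow> bideg_le (sum n S) (prod f S)"
proof (induction S rule: infinite_finite_induct)
  case (insert x S)
  then show ?case by (auto intro: bideg_le_mult)
qed (simp_all add: one_pCons bideg_le_const)

text \<open>When the bound splits into a row weight and a column weight, all terms of the Leibniz
  expansion get the same bound, since a permutation only rearranges the column weights.\<close>

lemma bideg_le_det:
  fixes X :: "'a::comm_ring_1 poly poly^'n^'n"
  assumes "\<And>i j. bideg_le (r i + c j) (X $ i $ j)"
  shows "bideg_le (sum r UNIV + sum c UNIV) (det X)"
  unfolding det_def
proof (rule bideg_le_sum)
  fix p :: "'n \<Rightarrow> 'n" assume "p \<in> {p. p permutes UNIV}"
  then have p: "p permutes UNIV" by simp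
  have "bideg_le (\<Sum>i\<in>UNIV. r i + c (p i)) (\<Prod>i\<in>UNIV. X $ i $ p i)"
    by (intro bideg_le_prod assms)
  also have "(\<Sum>i\<in>UNIV. r i + c (p i)) = sum r UNIV + sum c UNIV"
    using sum.permute[OF p, of c] by (simp add: sum.distrib o_def)
  finally show "bideg_le (sum r UNIV + sum c UNIV) (of_int (sign p) * (\<Prod>i\<in>UNIV. X $ i $ p i))"
    unfolding of_int_poly by (rule bideg_le_const_mult)
qed

text \<open>The coefficient of the product at \<open>(i, j + 1)\<close> is \<open>a\<close> times
  that of \<open>F\<close> at \<open>(i, j)\<close> plus \<open>c\<close> times that at
  \<open>(i - 1, j + 1)\<close>, and the latter is 0 by induction on \<open>i\<close>.\<close>

lemma bideg_le_cancel_linear: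
  fixes F :: "'a::idom poly poly"
  assumes "bideg_le (Suc n) ([:[:0, a:], [:c:]:] * F)" and "a \<noteq> 0"
  shows "bideg_le n F"
proof -
  have "coeff (coeff F i) j = 0" if "n < i + j" for i j
    using that
  proof (induction i arbitrary: j)
    case 0
    have "coeff (coeff ([:[:0, a:], [:c:]:] * F) 0) (Suc j) = 0"
      using 0 by (intro bideg_leD[OF assms(1)]) simp
    with assms(2) show ?case by (simp add: coeff_pCons)
  next
    case (Suc i)
    have "coeff (coeff ([:[:0, a:], [:c:]:] * F) (Suc i)) (Suc j) = 0"
      using Suc.prems by (intro bideg_leD[OF assms(1)]) simp
    moreover have "coeff (coeff F i) (Suc j) = 0"
      by (rule Suc.IH) (use Suc.prems in simp)
    ultimately show ?case using assms(2) by (simp add: coeff_pCons)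
  qed
  then show ?thesis
    by (meson bideg_le_def not_less)
qed

text \<open>
  The line in the direction \<open>Q\<close> with parameter \<open>Z\<close> (the outer variable), displaced by \<open>\<lambda>P\<close>.
\<close>

definition pencil :: "'a::comm_ring_1^3 \<Rightarrow> 'a^3 \<Rightarrow> 'a poly poly^3" where
  "pencil P Q = (\<chi> k. [:[:0, P $ k:], [:Q $ k:]:])"

abbreviation const2 :: "'a::comm_ring_1 \<Rightarrow> 'a poly poly" where
  "const2 a \<equiv> [:[:a:]:]"

lemma cring_hom_const2: "cring_hom (const2 :: 'a::comm_ring_1 \<Rightarrow> _)"
  by (rule cring_hom_comp[OF cring_hom_const_poly cring_hom_const_poly])

text \<open>
  The determinant has degree 3 and not 4, because \<open>(A\<^sub>i \<times> (C\<^sub>i + P)) \<bullet> P = (A\<^sub>i \<times> C\<^sub>i) \<bullet> P\<close>: replacing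
  its last column accordingly multiplies it by a coordinate of \<open>P\<close>.
\<close>

lemma bideg_le_platform_det:
  fixes A C :: "'a::idom^3^6" and P Q :: "'a^3"
  assumes "P $ 3 \<noteq> 0"
  shows "bideg_le 3 (platform_det (map_vec (map_vec const2) A) (map_vec (map_vec const2) C) (pencil P Q))"
proof -
  let ?A = "map_vec (map_vec const2) A" and ?C = "map_vec (map_vec const2) C" and ?P = "pencil P Q"
  define X where "X = row_subst 1 (join ?P 0) (leg_matrix ?A ?C ?P)"
  let ?Y = "\<chi> i j. if j = 6 then (X *v join 0 ?P) $ i else X $ i $ j"
  \<comment> \<open>The total weight is 4: one for row 1, which carries \<open>P\<close>, and one
    for each of the last three columns. Cancelling the linear form \<open>P $ 3\<close> leaves
    3.\<close>
  let ?r = "\<lambda>i::6. if i = 1 then 1::nat else 0" and ?c = "\<lambda>j::6. if j \<in> {4, 5, 6} then 1::nat else 0"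
  have P: "bideg_le 1 (?P $ k)" for k
    by (auto simp: pencil_def bideg_le_def coeff_pCons split: nat.splits)
  have const: "bideg_le n (?A $ i $ k)" "bideg_le n (?C $ i $ k)" for n i k
    by (simp_all add: map_vec_def bideg_le_const)
  have const_mult: "bideg_le n (?A $ i $ k * F)" if "bideg_le n F" for n i k F
    using bideg_le_const_mult[OF that] by (simp add: map_vec_def)
  have last: "(X *v join 0 ?P) $ i = (if i = 1 then 0 else
      ?A $ i $ 2 * (?C $ i $ 3 * ?P $ 1) - ?A $ i $ 3 * (?C $ i $ 2 * ?P $ 1) +
      ?A $ i $ 3 * (?C $ i $ 1 * ?P $ 2) - ?A $ i $ 1 * (?C $ i $ 3 * ?P $ 2) +
      ?A $ i $ 1 * (?C $ i $ 2 * ?P $ 3) - ?A $ i $ 2 * (?C $ i $ 1 * ?P $ 3))" for i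
  proof -
    have "(X *v join 0 ?P) $ i = dot (X $ i) (join 0 ?P)"
      by (simp add: matrix_vector_mult_def dot_def)
    then show ?thesis
      by (simp add: X_def row_subst_def leg_matrix_def dot_join) (simp add: dot_3 algebra_simps)
  qed
  have "\<forall>j. bideg_le (?r i + ?c j) (?Y $ i $ j)" for i
  proof (cases "i = 1")
    case True
    then show ?thesis
      using P by (simp add: forall_6 last) (simp add: X_def row_subst_def)
  next
    case False
    have C_mult: "bideg_le (Suc 0) (?C $ i $ k * ?P $ l)" for k l
      using bideg_le_const_mult[OF P[of l]] by (simp add: map_vec_def)
    from False show ?thesis
      using P const
      by (simp add: forall_6 last bideg_le_diff bideg_le_add const_mult C_mult)
        (simp add: X_def row_subst_def leg_matrix_def bideg_le_diff bideg_le_add const_mult)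
  qed
  then have "bideg_le (sum ?r UNIV + sum ?c UNIV) (det ?Y)"
    by (intro bideg_le_det) blast
  then have "bideg_le (Suc 3) (?P $ 3 * det X)"
    unfolding cramer_cring by (simp add: sum_6 eval_nat_numeral)
  then show ?thesis
    using assms unfolding platform_det_eq X_def pencil_def vec_lambda_beta
    by (rule bideg_le_cancel_linear)
qed

abbreviation spec0 :: "'a::comm_ring_1 poly poly \<Rightarrow> 'a poly" where
  "spec0 \<equiv> map_poly (\<lambda>p. poly p 0)"

lemma cring_hom_spec0: "cring_hom (spec0 :: 'a::comm_ring_1 poly poly \<Rightarrow> _)"
  by (rule cring_hom_map_poly[OF cring_hom_poly])

lemma spec0_eq_0_imp:
  fixes F :: "'a::idom poly poly"
  assumes "spec0 F = 0"
  obtains G where "F = [:[:0, 1:]:] * G"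
proof -
  have "[:0, 1:] dvd coeff F n" for n
  proof -
    have "coeff (spec0 F) n = 0" using assms by simp
    then have "poly (coeff F n) 0 = 0" by (simp add: coeff_map_poly)
    then show ?thesis using poly_eq_0_iff_dvd[of "coeff F n" 0] by simp
  qed
  then have "[:[:0, 1:]:] dvd F" by (simp add: const_poly_dvd_iff)
  then show ?thesis using that by (auto simp: dvd_def)
qed

text \<open>
  A polynomial of degree less than \<open>n\<close> in \<open>Z\<close> that is divisible by \<open>D\<close> after multiplication by \<open>h\<close>
  vanishes on the line \<open>\<lambda> = 0\<close>, as it has too many zeros there, so \<open>\<lambda>\<close> can be cancelled.
\<close>

lemma dvd_of_dvd_mult_pencil:
  fixes D h q :: "'a::idom poly poly"
  assumes D: "bideg_le n D" "coeff (coeff D n) 0 dvd 1"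
    and S: "card S = n" "\<And>x. x \<in> S \<Longrightarrow> poly (spec0 D) x = 0" "\<And>x. x \<in> S \<Longrightarrow> poly (spec0 h) x \<noteq> 0"
    and dvd: "D dvd h * q"
  shows "D dvd q"
proof -
  interpret spec0: cring_hom "spec0 :: 'a poly poly \<Rightarrow> _" by (rule cring_hom_spec0)
  define k where "k = coeff (coeff D n) 0"
  have "coeff (coeff D n) j = coeff [:k:] j" for j
    using bideg_leD[OF D(1), of n j] by (cases j) (simp_all add: k_def)
  then have lead: "coeff D n = [:k:]" by (rule poly_eqI)
  have k: "k \<noteq> 0" using D(2) by (auto simp: k_def)
  have degD: "degree D = n"
  proof (rule antisym)
    show "degree D \<le> n"
      by (intro degree_le allI impI poly_eqI) (simp add: bideg_leD[OF D(1)])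
    show "n \<le> degree D" using lead k by (intro le_degree) auto
  qed
  have D0: "D \<noteq> 0" using lead k by auto
  \<comment> \<open>Infinite descent: a nonzero \<open>t\<close> would be \<lambda> times another
    counterexample of the same degree in \<open>Z\<close>, whose leading coefficient has smaller
    degree in \<lambda>.\<close>
  have small: "t = 0" if "h * t = D * r" "t = 0 \<or> degree t < n" for t r
    using that
  proof (induction "degree (lead_coeff t)" arbitrary: t r rule: less_induct)
    case less
    show ?case
    proof (rule ccontr)
      assume t0: "t \<noteq> 0"
      have eq: "spec0 h * spec0 t = spec0 D * spec0 r"
        using less.prems(1) by (metis spec0.hom_mult)
      have "degree (spec0 t) \<le> degree t"
        by (intro degree_le allI impI) (simp add: coeff_map_poly coeff_eq_0)
      then have deg: "degree (spec0 t) < card S"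
        using less.prems(2) t0 S(1) by auto
      have root: "poly (spec0 t) x = 0" if "x \<in> S" for x
        using arg_cong[OF eq, of "\<lambda>p. poly p x"] S(2,3)[OF that] by simp
      have t: "spec0 t = 0"
        by (rule poly_eqI_degree[of S]) (use deg root in auto)
      then have "spec0 D * spec0 r = 0" using eq by simp
      moreover have "coeff (spec0 D) n \<noteq> 0" using k lead by (simp add: coeff_map_poly)
      then have "spec0 D \<noteq> 0" by auto
      ultimately have r: "spec0 r = 0" by simp
      obtain t' where t': "t = [:[:0, 1:]:] * t'" using spec0_eq_0_imp[OF t] .
      obtain r' where r': "r = [:[:0, 1:]:] * r'" using spec0_eq_0_imp[OF r] .
      have t'0: "t' \<noteq> 0" using t' t0 by auto
      have "[:[:0, 1:]:] * (h * t') = [:[:0, 1:]:] * (D * r')"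
        using less.prems(1) unfolding t' r' by (simp only: mult_ac)
      then have eq': "h * t' = D * r'"
        by (subst (asm) mult_cancel_left) simp
      have "lead_coeff t = [:0, 1:] * lead_coeff t'" by (simp add: t')
      then have "degree (lead_coeff t') < degree (lead_coeff t)"
        using t'0 by (simp add: degree_mult_eq)
      moreover have "degree t' = degree t" by (simp add: t')
      ultimately have "t' = 0"
        using less.hyps[of t' r'] eq' less.prems(2) t0 by simp
      with t'0 show False by simp
    qed
  qed
  \<comment> \<open>Pseudo-division scales \<open>q\<close> by a power of the leading coefficient of
    \<open>D\<close>. This is a unit, so the scaling can be undone once the remainder
    vanishes.\<close>
  obtain s t where st: "pseudo_divmod q D = (s, t)" by fastforce
  define c where "c = [:k:] ^ (Suc (degree q) - degree D)"
  have q: "smult c q = D * s + t" and t: "t = 0 \<or> degree t < degree D"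
    using pseudo_divmod[OF D0 st] by (simp_all add: c_def lead degD)
  obtain r where r: "h * q = D * r" using dvd by (auto simp: dvd_def)
  have "h * t = D * (smult c r - h * s)"
  proof -
    have "h * t = h * smult c q - h * (D * s)" unfolding q by (simp add: algebra_simps)
    also have "h * smult c q = smult c (D * r)" by (simp add: r)
    finally show ?thesis by (simp add: algebra_simps)
  qed
  then have "t = 0" using small t degD by blast
  then have dvd': "D dvd smult c q" using q by simp
  have "[:k:] dvd 1" using D(2) by (simp add: k_def one_pCons)
  then have "c dvd 1"
    unfolding c_def using dvd_power_same[of "[:k:]" 1] by simp
  then obtain c' where "c * c' = 1" by (auto simp: dvd_def)
  then have "q = smult c' (smult c q)" by (simp add: mult.commute)
  then show ?thesis using dvd_smult[OF dvd', of c'] by simp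
qed

section \<open>Birational maps from kernels\<close>

text \<open>
  A homomorphism to a field extends only to those fractions whose denominator it does not kill,
  so the extension is treated as a relation.
\<close>

definition pullback_rel :: "('a::idom \<Rightarrow> 'b::field) \<Rightarrow> 'a fract \<Rightarrow> 'b \<Rightarrow> bool" where
  "pullback_rel G x y \<longleftrightarrow> (\<exists>a b. x = Fract a b \<and> G b \<noteq> 0 \<and> y = G a / G b)"

context
  fixes G :: "'a::idom \<Rightarrow> 'b::field"
  assumes G: "cring_hom G"
begin

interpretation G: cring_hom G by (fact G)

lemma pullback_rel_unique:
  assumes "pullback_rel G x y" "pullback_rel G x y'"
  shows "y = y'"
proof -
  obtain a b a' b' where ab: "x = Fract a b" "G b \<noteq> 0" "y = G a / G b"
    and ab': "x = Fract a' b'" "G b' \<noteq> 0" "y' = G a' / G b'"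
    using assms unfolding pullback_rel_def by blast
  have "b \<noteq> 0" "b' \<noteq> 0" using ab(2) ab'(2) by (auto simp: G.hom_zero)
  then have "a * b' = a' * b" using ab(1) ab'(1) by (simp add: eq_fract)
  then have "G a * G b' = G a' * G b" by (metis G.hom_mult)
  then show ?thesis using ab(2) ab'(2) by (simp add: ab(3) ab'(3) frac_eq_eq)
qed

lemma pullback_rel_Fract: "pullback_rel G (Fract a 1) (G a)"
  unfolding pullback_rel_def by (rule exI[of _ a], rule exI[of _ 1]) (simp add: G.hom_one)

lemma pullback_rel_add:
  assumes "pullback_rel G x y" "pullback_rel G x' y'"
  shows "pullback_rel G (x + x') (y + y')"
proof -
  obtain a b a' b' where ab: "x = Fract a b" "G b \<noteq> 0" "y = G a / G b"
    and ab': "x' = Fract a' b'" "G b' \<noteq> 0" "y' = G a' / G b'"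
    using assms by (auto simp: pullback_rel_def)
  moreover have "b \<noteq> 0" "b' \<noteq> 0" using ab(2) ab'(2) by (auto simp: G.hom_zero)
  ultimately show ?thesis
    unfolding pullback_rel_def
    by (intro exI[of _ "a * b' + a' * b"] exI[of _ "b * b'"])
      (simp add: G.hom_add G.hom_mult add_frac_eq)
qed

lemma pullback_rel_mult:
  assumes "pullback_rel G x y" "pullback_rel G x' y'"
  shows "pullback_rel G (x * x') (y * y')"
proof -
  obtain a b a' b' where "x = Fract a b" "G b \<noteq> 0" "y = G a / G b"
    and "x' = Fract a' b'" "G b' \<noteq> 0" "y' = G a' / G b'"
    using assms by (auto simp: pullback_rel_def)
  then show ?thesis
    unfolding pullback_rel_def
    by (intro exI[of _ "a * a'"] exI[of _ "b * b'"]) (simp add: G.hom_mult)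
qed

lemma pullback_rel_divide:
  assumes "pullback_rel G x y" "pullback_rel G x' y'" "y' \<noteq> 0"
  shows "pullback_rel G (x / x') (y / y')"
proof -
  obtain a b a' b' where "x = Fract a b" "G b \<noteq> 0" "y = G a / G b"
    and "x' = Fract a' b'" "G b' \<noteq> 0" "y' = G a' / G b'"
    using assms by (auto simp: pullback_rel_def)
  then show ?thesis
    unfolding pullback_rel_def using assms(3)
    by (intro exI[of _ "a * b'"] exI[of _ "b * a'"]) (simp add: G.hom_mult)
qed

lemma pullback_rel_0: "pullback_rel G 0 0" and pullback_rel_1: "pullback_rel G 1 1"
  using pullback_rel_Fract[of 0] pullback_rel_Fract[of 1]
  by (simp_all add: G.hom_zero G.hom_one Zero_fract_def One_fract_def)

lemma pullback_rel_diff: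
  assumes "pullback_rel G x y" "pullback_rel G x' y'"
  shows "pullback_rel G (x - x') (y - y')"
proof -
  have "pullback_rel G (- 1) (- 1)"
    using pullback_rel_Fract[of "- 1"] by (simp add: G.hom_minus G.hom_one One_fract_def)
  from pullback_rel_add[OF assms(1) pullback_rel_mult[OF this assms(2)]] show ?thesis by simp
qed

lemma pullback_rel_sum:
  "(\<And>i. i \<in> S \<Longrightarrow> pullback_rel G (f i) (g i)) \<Longrightarrow> pullback_rel G (sum f S) (sum g S)"
  by (induction S rule: infinite_finite_induct) (simp_all add: pullback_rel_0 pullback_rel_add)

lemma pullback_rel_prod:
  "(\<And>i. i \<in> S \<Longrightarrow> pullback_rel G (f i) (g i)) \<Longrightarrow> pullback_rel G (prod f S) (prod g S)"
  by (induction S rule: infinite_finite_induct) (simp_all add: pullback_rel_1 pullback_rel_mult)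

lemma pullback_rel_power: "pullback_rel G x y \<Longrightarrow> pullback_rel G (x ^ k) (y ^ k)"
  by (induction k) (simp_all add: pullback_rel_1 pullback_rel_mult)

lemma pullback_rel_mpoly_eval:
  assumes "\<And>c. pullback_rel G (\<phi> c) (\<psi> c)" "\<And>i. pullback_rel G (x $ i) (y $ i)"
  shows "pullback_rel G (mpoly_eval \<phi> x p) (mpoly_eval \<psi> y p)"
  unfolding mpoly_eval_def
  by (intro pullback_rel_sum pullback_rel_mult pullback_rel_prod pullback_rel_power assms)

end

lemma mpoly_subst_vars:
  "mpoly_subst (\<chi> j. Fract (mpoly_var j) 1) p = Fract (p :: ('m::{finite,linorder}, 'k::field) mpoly) 1"
  using hom_mpoly_eval[OF cring_hom_Fract, of mpoly_const "\<chi> i. mpoly_var i" p]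
  by (simp add: mpoly_eval_vars mpoly_subst_eq_eval map_vec_def)

lemma mpoly_subst_const: "mpoly_subst f (mpoly_const c) = Fract (mpoly_const c) 1"
  by (simp add: mpoly_subst_eq_eval mpoly_eval_const cring_hom_Fract_const)

lemma mpoly_subst_var: "mpoly_subst f (mpoly_var i) = f $ i"
  by (simp add: mpoly_subst_eq_eval mpoly_eval_var cring_hom_Fract_const)

text \<open>The ideal of \<open>D\<close> is the kernel of a homomorphism to a field, hence prime,
  and a fraction vanishes on its variety iff it pulls back to 0 along \<open>g\<close>. The inverse
  map \<open>n / q\<close> pulls back to the coordinates, so dominance and both compositions can be
  checked after pullback.\<close>

lemma birationally_equivalent_affine_space:
  fixes g :: "(('m::{finite,linorder}, 'k::field) ratfun, 'n::{finite,linorder}) vec"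
    and D q :: "('n, 'k) mpoly" and n :: "(('n, 'k) mpoly, 'm) vec"
  assumes ker: "\<And>p. mpoly_subst g p = 0 \<longleftrightarrow> D dvd p"
    and q: "\<not> D dvd q"
    and inv: "\<And>j. mpoly_subst g (n $ j) = Fract (mpoly_var j) 1 * mpoly_subst g q"
  shows "birationally_equivalent {p. D dvd p} ({0} :: ('m, 'k) mpoly set)"
proof -
  let ?I = "{p. D dvd p}" and ?J = "{0} :: ('m, 'k) mpoly set"
  let ?R = "pullback_rel (mpoly_subst g)"
  define f where "f = (\<chi> j. Fract (n $ j) q)"
  have hom: "cring_hom (mpoly_subst g)" by (rule cring_hom_mpoly_subst)
  interpret g: cring_hom "mpoly_subst g" by (fact hom)
  have q': "mpoly_subst g q \<noteq> 0" using q ker by blast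
  have vanishing_I: "x \<in> vanishing_on ?I \<longleftrightarrow> ?R x 0" for x
    unfolding vanishing_on_def pullback_rel_def using ker by auto
  have regular_I: "x \<in> regular_at ?I" if "?R x y" for x y
    using that ker unfolding regular_at_def pullback_rel_def by auto
  have vanishing_J: "x \<in> vanishing_on ?J \<longleftrightarrow> x = 0" for x
  proof
    show "x \<in> vanishing_on ?J \<Longrightarrow> x = 0"
      by (auto simp: vanishing_on_def fract_collapse)
    show "x = 0 \<Longrightarrow> x \<in> vanishing_on ?J"
      unfolding vanishing_on_def by (auto simp: Zero_fract_def intro!: exI[of _ 1])
  qed
  have regular_J: "x \<in> regular_at ?J" for x
    by (cases x) (auto simp: regular_at_def)
  have f_rel: "?R (f $ j) (Fract (mpoly_var j) 1)" for j
    unfolding pullback_rel_def f_def using q' inv[of j]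
    by (intro exI[of _ "n $ j"] exI[of _ q]) simp
  have subst_f_rel: "?R (mpoly_subst f p) (Fract p 1)" for p
  proof -
    have "?R (Fract (mpoly_const c) 1) (Fract (mpoly_const c) 1)" for c
      using pullback_rel_Fract[OF hom, of "mpoly_const c"] by (simp add: mpoly_subst_const)
    then have "?R (mpoly_subst f p) (mpoly_subst (\<chi> j. Fract (mpoly_var j) 1) p)"
      unfolding mpoly_subst_eq_eval by (intro pullback_rel_mpoly_eval[OF hom[unfolded mpoly_subst_eq_eval]])
        (simp_all add: f_rel[unfolded mpoly_subst_eq_eval])
    then show ?thesis by (simp add: mpoly_subst_vars)
  qed
  have "prime_ideal ?I"
    unfolding prime_ideal_def
  proof (intro conjI)
    show "1 \<notin> ?I" using ker[of 1] by (simp add: g.hom_one)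
    have "D dvd a \<or> D dvd b" if "D dvd a * b" for a b
      using that by (simp add: g.hom_mult flip: ker)
    then show "\<forall>a b. a * b \<in> ?I \<longrightarrow> a \<in> ?I \<or> b \<in> ?I" by simp
  qed auto
  moreover have "prime_ideal ?J" by (simp add: prime_ideal_def)
  moreover have "dominant_rational_map ?I ?J f"
    unfolding dominant_rational_map_def
  proof (intro conjI allI)
    show "f $ j \<in> regular_at ?I" for j by (rule regular_I[OF f_rel])
    have "?R (mpoly_subst f p) 0 \<longleftrightarrow> Fract p 1 = 0" for p
      using subst_f_rel[of p] pullback_rel_unique[OF hom] by metis
    then show "mpoly_subst f p \<in> vanishing_on ?I \<longleftrightarrow> p \<in> ?J" for p
      by (simp add: vanishing_I Zero_fract_def eq_fract)
  qed
  moreover have "dominant_rational_map ?J ?I g"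
    unfolding dominant_rational_map_def by (simp add: regular_J vanishing_J ker)
  moreover have "comp_is_identity ?I ?J f g"
    unfolding comp_is_identity_def
  proof
    fix i
    obtain a b where ab: "g $ i = Fract a b" "b \<noteq> 0" by (cases "g $ i")
    have "?R (mpoly_subst f a / mpoly_subst f b) (Fract a 1 / Fract b 1)"
      by (intro pullback_rel_divide[OF hom] subst_f_rel) (simp add: ab(2) Zero_fract_def eq_fract)
    then have "?R (mpoly_subst f a / mpoly_subst f b - Fract (mpoly_var i) 1)
        (Fract a 1 / Fract b 1 - mpoly_subst g (mpoly_var i))"
      by (intro pullback_rel_diff[OF hom] pullback_rel_Fract[OF hom])
    then show "\<exists>p q. q \<notin> ?J \<and> g $ i = Fract p q \<and>
        mpoly_subst f p / mpoly_subst f q - Fract (mpoly_var i) 1 \<in> vanishing_on ?I"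
      using ab by (intro exI[of _ a] exI[of _ b]) (simp add: mpoly_subst_var vanishing_I)
  qed
  moreover have "comp_is_identity ?J ?I g f"
    unfolding comp_is_identity_def
  proof
    fix j
    show "\<exists>p q. q \<notin> ?I \<and> f $ j = Fract p q \<and>
        mpoly_subst g p / mpoly_subst g q - Fract (mpoly_var j) 1 \<in> vanishing_on ?J"
      using q q' by (intro exI[of _ "n $ j"] exI[of _ q]) (simp add: f_def inv vanishing_J)
  qed
  ultimately show ?thesis
    unfolding birationally_equivalent_def by blast
qed

section \<open>Platforms in general position\<close>

text \<open>
  On the line \<open>P = z C\<^sub>2\<close> the determinant is \<open>z (z + 1) (\<kappa> z + \<epsilon>) / 6\<close> for the two numbers
  defined next.
\<close>

definition line_kappa :: "'a::comm_ring_1^3^6 \<Rightarrow> 'a^3^6 \<Rightarrow> 'a" where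
  "line_kappa A C = platform_det A C (C $ 2) - platform_det A C (- 2 *s C $ 2)"

definition line_eps :: "'a::comm_ring_1^3^6 \<Rightarrow> 'a^3^6 \<Rightarrow> 'a" where
  "line_eps A C = 2 * platform_det A C (C $ 2) + platform_det A C (- 2 *s C $ 2)"

text \<open>The first three factors make the cubic on the line have degree 3 and its third zero
  differ from 0 and -1. The next three keep \<open>h\<close> from vanishing at the zeros; the third
  zero has denominator \<kappa>, which is cleared by scaling the platform. By the last factor, the
  chart \<open>w $ 1 = 1\<close> meets the image of the surface.\<close>

definition general_position :: "'a::comm_ring_1^3^6 \<Rightarrow> 'a^3^6 \<Rightarrow> 'a" where
  "general_position A C =
    line_kappa A C * line_eps A C * (line_kappa A C - line_eps A C) *
    par_den_twist A C 0 * par_den_twist A C (- C $ 2) *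
    par_den_twist A (map_vec ((*s) (line_kappa A C)) C) (- line_eps A C *s C $ 2) *
    lower (twist A C 0) $ 1"

lemma (in cring_hom) hom_general_position:
  "\<phi> (general_position A C) =
    general_position (map_vec (map_vec \<phi>) A) (map_vec (map_vec \<phi>) C)"
proof -
  let ?A = "map_vec (map_vec \<phi>) A" and ?C = "map_vec (map_vec \<phi>) C"
  have C2: "map_vec \<phi> (C $ 2) = ?C $ 2" by (simp add: map_vec_def)
  have neg: "map_vec \<phi> (- v) = - map_vec \<phi> v" for v :: "'a^3"
    by (simp add: map_vec_def vec_eq_iff hom_minus)
  have kappa: "\<phi> (line_kappa A C) = line_kappa ?A ?C"
    by (simp add: line_kappa_def hom_diff hom_platform_det map_vec_smult C2 hom_minus hom_numeral)
  have eps: "\<phi> (line_eps A C) = line_eps ?A ?C"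
    by (simp add: line_eps_def hom_add hom_mult hom_platform_det map_vec_smult C2 hom_minus hom_numeral)
  have scale: "map_vec (map_vec \<phi>) (map_vec ((*s) k) C) = map_vec ((*s) (\<phi> k)) ?C" for k
    by (simp add: map_vec_def vec_eq_iff hom_mult)
  have twist0: "\<phi> (twist A C 0 $ 4) = twist ?A ?C 0 $ 4"
    using arg_cong[OF map_vec_twist[of A C 0], of "\<lambda>v. v $ 4"]
    by (simp add: map_vec_zero) (simp add: map_vec_def)
  show ?thesis
    by (simp add: general_position_def hom_mult hom_diff kappa eps hom_par_den_twist map_vec_zero
        neg C2 scale map_vec_smult hom_minus twist0)
qed

section \<open>Scaling the offsets\<close>

lemma prod_if_1_6: "(\<Prod>i\<in>UNIV. if i = (1::6) then 1 else c) = (c::'a::comm_ring_1) ^ 5"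
  unfolding UNIV_6 by (simp add: eval_nat_numeral)

lemma twist_scale:
  "twist A (map_vec ((*s) c) C) (c *s P) = c ^ 5 *s twist A C P"
proof -
  have "twist A (map_vec ((*s) c) C) (c *s P) $ k = c ^ 5 * twist A C P $ k" for k
  proof -
    let ?r = "\<lambda>i. if i = (1::6) then 1 else c"
    let ?X = "row_subst 1 (axis k 1) (leg_matrix A C P)"
    have leg: "join (c *s v) (cross a (c *s v + c *s P)) = c *s join v (cross a (v + P))" for a v
      by (simp add: vec_eq_iff forall_6 algebra_simps)
    have "row_subst 1 (axis k 1) (leg_matrix A (map_vec ((*s) c) C) (c *s P)) =
        (\<chi> i j. ?r i * (\<lambda>_. 1) j * ?X $ i $ j)"
      by (auto simp: vec_eq_iff row_subst_def leg_matrix_def map_vec_def leg)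
    then show ?thesis
      using det_scale_rows_cols[of ?r "\<lambda>_. 1" ?X]
      by (simp add: twist_def row_cofactor_def prod_if_1_6)
  qed
  then show ?thesis by (simp add: vec_eq_iff)
qed

lemma vel_den_scale_offsets: "vel_den A (map_vec ((*s) c) C) w = c ^ 3 * vel_den A C w"
proof -
  let ?c = "\<lambda>j::6. if j \<in> {1, 2, 3} then c else 1"
  have "vel_matrix A (map_vec ((*s) c) C) w = (\<chi> i j. (\<lambda>_. 1) i * ?c j * vel_matrix A C w $ i $ j)"
    unfolding vec_eq_iff forall_6 vel_matrix_def row_subst_def map_vec_def by simp
  then have "vel_den A (map_vec ((*s) c) C) w = prod ?c UNIV * vel_den A C w"
    unfolding vel_den_def using det_scale_rows_cols[of "\<lambda>_. 1" ?c "vel_matrix A C w"] by simp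
  also have "prod ?c UNIV = c ^ 3"
    unfolding UNIV_6 by (simp add: eval_nat_numeral)
  finally show ?thesis .
qed

text \<open>The twist has weight 5, so \<open>vel_den\<close> has weight 3 + 5; twice 8 from its
  square and twice 5 from the dot product give 26.\<close>

lemma par_den_twist_scale:
  "par_den_twist A (map_vec ((*s) c) C) (c *s P) = c ^ 26 * par_den_twist A C P"
proof -
  have l: "lower (a *s v) = a *s lower v" and u: "upper (a *s v) = a *s upper v" for a and v :: "'a^6"
    by (simp_all add: vec_eq_iff forall_3)
  have d: "dot (a *s u) (a *s v) = a ^ 2 * dot u v" for a and u v :: "'a^3"
    by (simp add: dot_3 power2_eq_square algebra_simps)
  show ?thesis
    by (simp add: par_den_twist_def twist_scale l u d vel_den_scale vel_den_scale_offsets)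
      (simp add: eval_nat_numeral mult_ac)
qed

lemma single_eq_0_iff: "Poly_Mapping.single m c = 0 \<longleftrightarrow> c = 0"
  by (metis lookup_single_eq lookup_zero single_zero)

lemma platform_det_at_0: "platform_det A C 0 = 0"
  by (simp add: platform_det_def dot_def)

text \<open>Leg 2 has length zero there, so its equation reduces to
  \<open>dot (C $ 2) u = 0\<close>, which up to sign is that of the first leg.\<close>

lemma platform_det_at_minus_offset: "platform_det A C (- C $ 2) = 0"
proof -
  have "dot (C $ 2) (upper (twist A C (- C $ 2))) = 0"
    using leg_twist[of 2 C A "- C $ 2"] by (simp add: dot_3[of "cross _ _"])
  then show ?thesis
    by (simp add: platform_det_def dot_def sum_negf)
qed

section \<open>The determinant on the pencil and the cancellation of \<open>h\<close>\<close>

locale general_platform =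
  fixes A C :: "'k::field^3^6"
  assumes general: "general_position A C \<noteq> 0"
begin

definition \<kappa> where "\<kappa> = line_kappa A C"
definition \<epsilon> where "\<epsilon> = line_eps A C"

lemma kappa_eps: "\<kappa> \<noteq> 0" "\<epsilon> \<noteq> 0" "\<kappa> \<noteq> \<epsilon>"
  using general by (auto simp: general_position_def \<kappa>_def \<epsilon>_def)

abbreviation lift :: "'k^3^6 \<Rightarrow> ('n, 'k) mpoly^3^6" where
  "lift \<equiv> map_vec (map_vec mpoly_const)"

abbreviation X :: "(3, 'k) mpoly^3" where
  "X \<equiv> \<chi> k. mpoly_var k"

definition D :: "(3, 'k) mpoly" where
  "D = platform_det (lift A) (lift C) X"

definition T :: "(3, 'k) mpoly^6" where
  "T = twist (lift A) (lift C) X"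

definition h :: "(3, 'k) mpoly" where
  "h = par_den_twist (lift A) (lift C) X"

definition line_point :: "'k \<Rightarrow> 'k^3" where
  "line_point c = c *s C $ 2"

lemma eval_consts:
  assumes "cring_hom (\<psi> :: 'k \<Rightarrow> 'r::comm_ring_1)"
  shows "map_vec (map_vec (mpoly_eval \<psi> x)) (lift B) = map_vec (map_vec \<psi>) B"
  using assms by (simp add: map_vec_def mpoly_eval_const)

lemma eval_X:
  assumes "cring_hom (\<psi> :: 'k \<Rightarrow> 'r::comm_ring_1)"
  shows "map_vec (mpoly_eval \<psi> x) X = x"
  using assms by (simp add: map_vec_def mpoly_eval_var vec_eq_iff)

lemma eval_D:
  assumes "cring_hom (\<psi> :: 'k \<Rightarrow> 'r::comm_ring_1)"
  shows "mpoly_eval \<psi> x D = platform_det (map_vec (map_vec \<psi>) A) (map_vec (map_vec \<psi>) C) x"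
  unfolding D_def cring_hom.hom_platform_det[OF cring_hom_mpoly_eval[OF assms]]
    eval_consts[OF assms] eval_X[OF assms] ..

lemma eval_h:
  assumes "cring_hom (\<psi> :: 'k \<Rightarrow> 'r::comm_ring_1)"
  shows "mpoly_eval \<psi> x h = par_den_twist (map_vec (map_vec \<psi>) A) (map_vec (map_vec \<psi>) C) x"
  unfolding h_def cring_hom.hom_par_den_twist[OF cring_hom_mpoly_eval[OF assms]]
    eval_consts[OF assms] eval_X[OF assms] ..

lemma eval_T:
  assumes "cring_hom (\<psi> :: 'k \<Rightarrow> 'r::comm_ring_1)"
  shows "map_vec (mpoly_eval \<psi> x) T = twist (map_vec (map_vec \<psi>) A) (map_vec (map_vec \<psi>) C) x"
  unfolding T_def cring_hom.map_vec_twist[OF cring_hom_mpoly_eval[OF assms]]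
    eval_consts[OF assms] eval_X[OF assms] ..

lemma mpoly_const_eq_0_iff: "(mpoly_const c :: ('n, 'k) mpoly) = 0 \<longleftrightarrow> c = 0"
  by (simp add: mpoly_const_def single_eq_0_iff)

text \<open>Restriction to the points \<lambda> X + Z \<open>C\<^sub>2\<close> for the generic point
  \<open>X\<close>. Since \<lambda> = 1, Z = 0 gives \<open>p\<close> back, divisibility may be
  tested after applying \<Phi>.\<close>

definition \<Phi> :: "(3, 'k) mpoly \<Rightarrow> (3, 'k) mpoly poly poly" where
  "\<Phi> = mpoly_eval (\<lambda>c. const2 (mpoly_const c)) (pencil X (map_vec mpoly_const (C $ 2)))"

lemma cring_hom_const2_mpoly: "cring_hom (\<lambda>c::'k. const2 (mpoly_const c :: (3, 'k) mpoly))"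
  by (rule cring_hom_comp[OF cring_hom_mpoly_const cring_hom_const2])

lemma cring_hom_Phi: "cring_hom \<Phi>"
  unfolding \<Phi>_def by (intro cring_hom_mpoly_eval cring_hom_const2_mpoly)

lemma Phi_inverse: "poly (poly (\<Phi> p) 0) 1 = p"
proof -
  have "cring_hom (\<lambda>F :: (3, 'k) mpoly poly poly. poly (poly F 0) 1)"
    by (intro cring_hom_comp[OF cring_hom_poly cring_hom_poly])
  then show ?thesis
    unfolding \<Phi>_def hom_mpoly_eval[OF \<open>cring_hom _\<close>]
    by (simp add: map_vec_def pencil_def mpoly_eval_vars)
qed

lemma Phi_on_line:
  "poly (spec0 (\<Phi> p)) (mpoly_const c) = mpoly_const (mpoly_eval (\<lambda>a. a) (line_point c) p)"
proof -
  have 1: "cring_hom (\<lambda>F :: (3, 'k) mpoly poly poly. poly (spec0 F) (mpoly_const c))"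
    by (intro cring_hom_comp[OF cring_hom_spec0 cring_hom_poly])
  have mult: "mpoly_const (a * b) = mpoly_const a * (mpoly_const b :: (3, 'k) mpoly)" for a b :: 'k
    using cring_hom.hom_mult[OF cring_hom_mpoly_const] .
  have "poly (spec0 (\<Phi> p)) (mpoly_const c) = mpoly_eval mpoly_const (map_vec mpoly_const (line_point c)) p"
    unfolding \<Phi>_def hom_mpoly_eval[OF 1]
    by (rule arg_cong2[where f = "\<lambda>f x. mpoly_eval f x p"])
      (auto simp: map_vec_def pencil_def line_point_def vec_eq_iff mult map_poly_pCons)
  also have "\<dots> = mpoly_const (mpoly_eval (\<lambda>a. a) (line_point c) p)"
    by (rule hom_mpoly_eval[OF cring_hom_mpoly_const, symmetric])
  finally show ?thesis .
qed

lemma cring_hom_id: "cring_hom (\<lambda>a::'k. a)"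
  by standard simp_all

lemma map_vec_id: "map_vec (map_vec (\<lambda>a. a)) B = B"
  by (simp add: map_vec_def)

lemma D_on_line: "poly (spec0 (\<Phi> D)) (mpoly_const c) = mpoly_const (platform_det A C (line_point c))"
  by (simp add: Phi_on_line eval_D cring_hom_id map_vec_id)

lemma h_on_line: "poly (spec0 (\<Phi> h)) (mpoly_const c) = mpoly_const (par_den_twist A C (line_point c))"
  by (simp add: Phi_on_line eval_h cring_hom_id map_vec_id)

lemma bideg_le_Phi_D: "bideg_le 3 (\<Phi> D)"
proof -
  have "mpoly_var 3 \<noteq> (0 :: (3, 'k) mpoly)"
    by (simp add: mpoly_var_def single_eq_0_iff)
  moreover have "map_vec (map_vec (\<lambda>c. const2 (mpoly_const c))) B =
      map_vec (map_vec const2) (lift B :: ((3, 'k) mpoly)^3^6)" for B :: "'k^3^6"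
    by (simp add: map_vec_def)
  ultimately show ?thesis
    unfolding \<Phi>_def eval_D[OF cring_hom_const2_mpoly] by (simp add: bideg_le_platform_det)
qed

text \<open>The zeros 0 and -1 leave two unknown coefficients, which the values at 1 and -2
  determine. The factor 6 is the price for solving without division.\<close>

lemma line_cubic:
  defines "E \<equiv> spec0 (\<Phi> D)"
  shows "6 * coeff E 3 = mpoly_const \<kappa>"
    and "6 * poly E (mpoly_const z) = mpoly_const (z * (z + 1) * (\<kappa> * z + \<epsilon>))"
proof -
  interpret c: cring_hom "mpoly_const :: 'k \<Rightarrow> (3, 'k) mpoly" by (rule cring_hom_mpoly_const)
  let ?d = "\<lambda>c. platform_det A C (line_point c)"
  have coeff_E: "coeff E i = 0" if "3 < i" for i
    using bideg_leD[OF bideg_le_Phi_D, of i 0] that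
    by (simp add: E_def coeff_map_poly poly_0_coeff_0)
  then have deg: "degree E \<le> 3" by (intro degree_le) auto
  have E4: "poly E x = coeff E 0 + coeff E 1 * x + coeff E 2 * x ^ 2 + coeff E 3 * x ^ 3" for x
  proof -
    have "poly E x = (\<Sum>i\<le>3. coeff E i * x ^ i)"
      unfolding poly_altdef using deg by (intro sum.mono_neutral_left) (auto simp: coeff_eq_0)
    then show ?thesis by (simp add: eval_nat_numeral)
  qed
  have E_const: "poly E (mpoly_const c) = mpoly_const (?d c)" for c
    unfolding E_def by (rule D_on_line)
  have "mpoly_const (?d 0) = (0 :: (3, 'k) mpoly)"
    by (simp add: line_point_def platform_det_at_0 c.hom_zero)
  then have E0: "coeff E 0 = 0"
    using E_const[of 0] by (simp add: c.hom_zero poly_0_coeff_0)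
  have E: "poly E x = coeff E 1 * x + coeff E 2 * x ^ 2 + coeff E 3 * x ^ 3" for x
    unfolding E4 E0 by simp
  have "?d (- 1) = 0"
    using platform_det_at_minus_offset[of A C] by (simp add: line_point_def)
  then have E1: "coeff E 2 = coeff E 1 + coeff E 3"
    using E_const[of "- 1"] unfolding E
    by (simp add: c.hom_zero c.hom_minus c.hom_one algebra_simps)
  have E2: "mpoly_const (?d 1) = 2 * coeff E 1 + 2 * coeff E 3"
    using E_const[of 1] unfolding E E1 by (simp add: c.hom_one algebra_simps)
  have E3: "mpoly_const (?d (- 2)) = 2 * coeff E 1 - 4 * coeff E 3"
    using E_const[of "- 2"] unfolding E E1 by (simp add: c.hom_minus c.hom_numeral algebra_simps)
  show kappa: "6 * coeff E 3 = mpoly_const \<kappa>"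
    using E2 E3 by (simp add: \<kappa>_def line_kappa_def c.hom_diff line_point_def)
  have eps: "6 * coeff E 1 = mpoly_const \<epsilon>"
    using E2 E3
    by (simp add: \<epsilon>_def line_eps_def c.hom_add c.hom_mult c.hom_numeral line_point_def)
  show "6 * poly E (mpoly_const z) = mpoly_const (z * (z + 1) * (\<kappa> * z + \<epsilon>))"
    unfolding E E1 c.hom_mult c.hom_add c.hom_one kappa[symmetric] eps[symmetric]
    by (simp add: algebra_simps power2_eq_square power3_eq_cube)
qed

lemma third_point: "par_den_twist A C (line_point (- \<epsilon> / \<kappa>)) \<noteq> 0"
proof -
  have "- \<epsilon> *s C $ 2 = \<kappa> *s line_point (- \<epsilon> / \<kappa>)"
    using kappa_eps(1) by (simp add: line_point_def vec_eq_iff)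
  then show ?thesis
    using general par_den_twist_scale[of A \<kappa> C "line_point (- \<epsilon> / \<kappa>)"]
    by (auto simp: general_position_def simp flip: \<kappa>_def \<epsilon>_def)
qed

lemma dvd_of_dvd_h_mult:
  assumes "D dvd h * p"
  shows "D dvd p"
proof -
  interpret c: cring_hom "mpoly_const :: 'k \<Rightarrow> (3, 'k) mpoly" by (rule cring_hom_mpoly_const)
  interpret \<Phi>: cring_hom \<Phi> by (rule cring_hom_Phi)
  let ?c = "mpoly_const :: 'k \<Rightarrow> (3, 'k) mpoly"
  let ?z = "- \<epsilon> / \<kappa>"
  \<comment> \<open>The characteristic is arbitrary so far; 6 is nonzero because it divides the
    nonzero constant \<kappa>.\<close>
  have six: "(6 :: (3, 'k) mpoly) \<noteq> 0"
    using line_cubic(1) kappa_eps(1) by (metis mpoly_const_eq_0_iff mult_zero_left)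
  have inj: "?c a = ?c b \<longleftrightarrow> a = b" for a b
    by (metis c.hom_diff mpoly_const_eq_0_iff right_minus_eq)
  have z: "?z \<noteq> 0" "?z \<noteq> - 1" "(-1 :: 'k) \<noteq> 0"
    using kappa_eps by (auto simp: field_simps)
  have "D dvd p" if "\<Phi> D dvd \<Phi> p"
  proof -
    have "poly (poly (\<Phi> D) 0) 1 dvd poly (poly (\<Phi> p) 0) 1"
      using that by (auto simp: dvd_def)
    then show ?thesis by (simp add: Phi_inverse)
  qed
  moreover have "\<Phi> D dvd \<Phi> p"
  proof (rule dvd_of_dvd_mult_pencil[where n = 3 and S = "?c ` {0, - 1, ?z}" and h = "\<Phi> h"])
    show "bideg_le 3 (\<Phi> D)" by (rule bideg_le_Phi_D)
    have "coeff (coeff (\<Phi> D) 3) 0 * (6 * ?c (1 / \<kappa>)) = ?c 1"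
    proof -
      have "6 * coeff (coeff (\<Phi> D) 3) 0 = ?c \<kappa>"
        using line_cubic(1) by (simp add: coeff_map_poly poly_0_coeff_0)
      moreover have "?c \<kappa> * ?c (1 / \<kappa>) = ?c 1"
        using kappa_eps(1) by (simp flip: c.hom_mult)
      ultimately show ?thesis by (metis mult.assoc mult.commute)
    qed
    then show "coeff (coeff (\<Phi> D) 3) 0 dvd 1"
      by (metis c.hom_one dvd_triv_left)
    have "inj_on ?c {0, - 1, ?z}" by (simp add: inj_on_def inj)
    then show "card (?c ` {0, - 1, ?z}) = 3"
      using z by (subst card_image) auto
    show "poly (spec0 (\<Phi> D)) x = 0" if x: "x \<in> ?c ` {0, - 1, ?z}" for x
    proof -
      obtain a where a: "x = ?c a" "a \<in> {0, - 1, ?z}" using x by blast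
      then have "a * (a + 1) * (\<kappa> * a + \<epsilon>) = 0" using kappa_eps(1) by auto
      then have "6 * poly (spec0 (\<Phi> D)) x = 0"
        unfolding a(1) line_cubic(2) by (simp only: c.hom_zero)
      with six show ?thesis by simp
    qed
    show "poly (spec0 (\<Phi> h)) x \<noteq> 0" if "x \<in> ?c ` {0, - 1, ?z}" for x
    proof -
      have "par_den_twist A C 0 \<noteq> 0" "par_den_twist A C (- C $ 2) \<noteq> 0"
        using general by (auto simp: general_position_def)
      then have "par_den_twist A C (line_point a) \<noteq> 0" if "a \<in> {0, - 1, ?z}" for a
        using that third_point by (auto simp: line_point_def)
      with that show ?thesis by (auto simp: h_on_line mpoly_const_eq_0_iff)
    qed
    show "\<Phi> D dvd \<Phi> h * \<Phi> p"
      using \<Phi>.hom_dvd[OF assms] by (simp add: \<Phi>.hom_mult)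
  qed
  ultimately show ?thesis by blast
qed

lemma dvd_of_dvd_h_power_mult: "D dvd h ^ n * p \<Longrightarrow> D dvd p"
  by (induction n) (auto simp: mult.assoc dest: dvd_of_dvd_h_mult)

end

section \<open>The parametrisation and its inverse\<close>

context general_platform
begin

text \<open>An affine chart of the projective plane of directions \<open>w\<close>.\<close>

definition W :: "(2, 'k) mpoly^3" where
  "W = vector [1, mpoly_var 1, mpoly_var 2]"

definition g_num :: "(2, 'k) mpoly^3" where
  "g_num = par_num (lift A) (lift C) W"

definition g_den :: "(2, 'k) mpoly" where
  "g_den = par_den (lift A) (lift C) W"

definition g :: "((2, 'k) ratfun, 3) vec" where
  "g = (\<chi> i. Fract (g_num $ i) g_den)"

definition lift_frac :: "'k^3^6 \<Rightarrow> (('n::{finite,linorder}, 'k) ratfun)^3^6" where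
  "lift_frac B = map_vec (map_vec (\<lambda>c. Fract (mpoly_const c) 1)) B"

lemma Fract_1_eq_0_iff: "Fract (a::'a::idom) 1 = 0 \<longleftrightarrow> a = 0"
  by (simp add: Zero_fract_def eq_fract)

lemma lift_frac_eq: "map_vec (map_vec (\<lambda>a. Fract a 1)) (lift B) = lift_frac B"
  by (simp add: lift_frac_def map_vec_def)

text \<open>The origin lies on the surface, and general position keeps the first coordinate of the
  angular velocity from vanishing there.\<close>

lemma not_dvd_T: "\<not> D dvd lower T $ 1"
proof
  assume dvd: "D dvd lower T $ 1"
  interpret e: cring_hom "mpoly_eval (\<lambda>a. a) (0 :: 'k^3)"
    by (intro cring_hom_mpoly_eval cring_hom_id)
  have "mpoly_eval (\<lambda>a. a) 0 D = 0"
    by (simp add: eval_D cring_hom_id map_vec_id platform_det_at_0)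
  moreover have "mpoly_eval (\<lambda>a. a) 0 (lower T $ 1) = lower (twist A C 0) $ 1"
    using arg_cong[OF eval_T[OF cring_hom_id, of 0], of "\<lambda>v. v $ 4"]
    by (simp add: map_vec_id) (simp add: map_vec_def)
  ultimately have "lower (twist A C 0) $ 1 = 0"
    using e.hom_dvd[OF dvd] by simp
  then show False using general by (simp add: general_position_def)
qed

lemma lower_T_nonzero: "lower T $ 1 \<noteq> 0"
  using not_dvd_T by auto

lemma inverse_T_nonzero: "Fract 1 (lower T $ 1) \<noteq> 0"
  using lower_T_nonzero by (simp add: Zero_fract_def eq_fract)

lemma h_nonzero: "h \<noteq> 0"
proof
  assume "h = 0"
  then have "D dvd h * 1" by simp
  then have "D dvd 1" by (rule dvd_of_dvd_h_mult)
  then have "D dvd lower T $ 1" by (rule dvd_trans) simp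
  with not_dvd_T show False by simp
qed

definition f :: "((3, 'k) ratfun, 2) vec" where
  "f = (\<chi> j. Fract (vector [lower T $ 2, lower T $ 3] $ j) (lower T $ 1))"

lemma f_W:
  "map_vec (mpoly_subst f) W = Fract 1 (lower T $ 1) *s map_vec (\<lambda>a. Fract a 1) (lower T)"
proof -
  interpret f: cring_hom "mpoly_subst f" by (rule cring_hom_mpoly_subst)
  show ?thesis
    using lower_T_nonzero
    by (simp add: vec_eq_iff forall_3 map_vec_def W_def f.hom_one mpoly_subst_var)
      (simp add: f_def One_fract_def eq_fract)
qed

lemma f_lift: "map_vec (map_vec (mpoly_subst f)) (lift B) = lift_frac B"
  by (simp add: map_vec_def lift_frac_def mpoly_subst_const)

lemma f_g_den: "mpoly_subst f g_den = Fract 1 (lower T $ 1) ^ 4 * Fract h 1"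
proof -
  interpret F: cring_hom "\<lambda>a::(3, 'k) mpoly. Fract a 1" by (rule cring_hom_Fract)
  interpret f: cring_hom "mpoly_subst f" by (rule cring_hom_mpoly_subst)
  have "par_den (lift_frac A) (lift_frac C) (map_vec (\<lambda>a. Fract a 1) (lower T)) = Fract h 1"
    unfolding lift_frac_eq[symmetric] F.hom_par_den[symmetric]
    by (simp add: T_def h_def par_den_lower_twist)
  then show ?thesis
    by (simp add: g_den_def f.hom_par_den f_W f_lift par_den_scale)
qed

lemma f_g_num:
  "map_vec (mpoly_subst f) g_num =
    Fract 1 (lower T $ 1) ^ 4 *s map_vec (\<lambda>a. Fract a 1) (par_num (lift A) (lift C) (lower T))"
proof -
  interpret F: cring_hom "\<lambda>a::(3, 'k) mpoly. Fract a 1" by (rule cring_hom_Fract)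
  interpret f: cring_hom "mpoly_subst f" by (rule cring_hom_mpoly_subst)
  show ?thesis
    by (simp add: g_num_def f.map_vec_par_num f_W f_lift par_num_scale F.map_vec_par_num lift_frac_eq)
qed

lemma g_den_nonzero: "g_den \<noteq> 0"
proof
  interpret f: cring_hom "mpoly_subst f" by (rule cring_hom_mpoly_subst)
  assume "g_den = 0"
  then have "Fract 1 (lower T $ 1) ^ 4 * Fract h 1 = 0"
    by (metis f_g_den f.hom_zero)
  then show False
    using h_nonzero inverse_T_nonzero by (simp add: Fract_1_eq_0_iff)
qed

text \<open>Congruence modulo \<open>D\<close> is meaningful for polynomials but not in the fraction
  field, so the denominators of \<open>p(g)\<close> are cleared by homogenisation before
  \<open>f\<close> is substituted. By homogeneity of degree 4, \<open>W\<close> may then be replaced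
  by \<open>lower T\<close>, where the denominator is \<open>h\<close> and the numerators are
  congruent to \<open>h *s X\<close>; this leaves \<open>h ^ N * p\<close>.\<close>

lemma dvd_of_subst_g:
  assumes "mpoly_subst g p = 0"
  shows "D dvd p"
proof -
  interpret f: cring_hom "mpoly_subst f" by (rule cring_hom_mpoly_subst)
  let ?N = "mpoly_tdeg p" and ?i = "Fract 1 (lower T $ 1) ^ 4"
  let ?n = "par_num (lift A) (lift C) (lower T)"
  define H where "H = mpoly_heval mpoly_const ?N g_den g_num p"
  have "map_vec (\<lambda>a. Fract a 1) g_num = Fract g_den 1 *s g"
    using g_den_nonzero by (simp add: vec_eq_iff map_vec_def g_def eq_fract)
  then have "Fract H 1 = mpoly_heval (\<lambda>c. Fract (mpoly_const c) 1) ?N (Fract g_den 1 * 1) (Fract g_den 1 *s g) p"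
    unfolding H_def hom_mpoly_heval[OF cring_hom_Fract] by simp
  also have "\<dots> = 0"
    unfolding mpoly_heval_scale[OF order_refl] mpoly_heval_one
    using assms by (simp add: mpoly_subst_eq_eval)
  finally have H: "H = 0" by (simp add: Fract_1_eq_0_iff)
  have "mpoly_subst f H = mpoly_heval (\<lambda>c. Fract (mpoly_const c) 1) ?N (?i * Fract h 1)
      (?i *s map_vec (\<lambda>a. Fract a 1) ?n) p"
    unfolding H_def hom_mpoly_heval[OF cring_hom_mpoly_subst] mpoly_subst_const f_g_den f_g_num ..
  also have "\<dots> = ?i ^ ?N * Fract (mpoly_heval mpoly_const ?N h ?n p) 1"
    unfolding mpoly_heval_scale[OF order_refl] hom_mpoly_heval[OF cring_hom_Fract] ..
  finally have "?i ^ ?N * Fract (mpoly_heval mpoly_const ?N h ?n p) 1 = 0"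
    using H by (simp add: f.hom_zero)
  moreover have "?i \<noteq> 0"
    using inverse_T_nonzero by simp
  ultimately have zero: "mpoly_heval mpoly_const ?N h ?n p = 0"
    by (simp add: Fract_1_eq_0_iff)
  have "?n = h *s X - (vel_den (lift A) (lift C) (lower T) ^ 2 * D) *s lower T"
    unfolding T_def h_def D_def by (rule par_num_lower_twist)
  then have "D dvd ?n $ i - (h *s X) $ i" for i
    by simp
  then have "D dvd mpoly_heval mpoly_const ?N h ?n p - mpoly_heval mpoly_const ?N (h * 1) (h *s X) p"
    by (simp add: mpoly_heval_cong_mod)
  then have "D dvd h ^ ?N * p"
    unfolding zero mpoly_heval_scale[OF order_refl] mpoly_heval_one mpoly_eval_vars by simp
  then show ?thesis by (rule dvd_of_dvd_h_power_mult)
qed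

lemma at_parameter:
  shows "platform_det (lift_frac A) (lift_frac C) g = 0"
    and "lower (twist (lift_frac A) (lift_frac C) g) $ k =
      Fract (W $ k) 1 * lower (twist (lift_frac A) (lift_frac C) g) $ 1"
proof -
  interpret F: cring_hom "\<lambda>a::(2, 'k) mpoly. Fract a 1" by (rule cring_hom_Fract)
  let ?w = "map_vec (\<lambda>a. Fract a 1) W"
  have den: "par_den (lift_frac A) (lift_frac C) ?w = Fract g_den 1"
    unfolding lift_frac_eq[symmetric] F.hom_par_den[symmetric] by (simp add: g_den_def)
  have num: "par_num (lift_frac A) (lift_frac C) ?w = map_vec (\<lambda>a. Fract a 1) g_num"
    unfolding lift_frac_eq[symmetric] F.map_vec_par_num[symmetric] by (simp add: g_num_def)
  have g: "g = (\<chi> i. par_num (lift_frac A) (lift_frac C) ?w $ i / par_den (lift_frac A) (lift_frac C) ?w)"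
    unfolding den num by (simp add: g_def map_vec_def)
  have w1: "?w $ 1 = 1" by (simp add: map_vec_def W_def One_fract_def)
  have nz: "par_den (lift_frac A) (lift_frac C) ?w \<noteq> 0"
    by (simp add: den Fract_1_eq_0_iff g_den_nonzero)
  show "platform_det (lift_frac A) (lift_frac C) g = 0"
    using twist_at_parameter(2)[OF nz, of 1] w1 unfolding g[symmetric] by simp
  show "lower (twist (lift_frac A) (lift_frac C) g) $ k =
      Fract (W $ k) 1 * lower (twist (lift_frac A) (lift_frac C) g) $ 1"
    using twist_at_parameter(1)[OF nz, of 1 k] unfolding g[symmetric] w1 by (simp add: map_vec_def)
qed

lemma subst_g_eq_0_iff: "mpoly_subst g p = 0 \<longleftrightarrow> D dvd p"
proof
  interpret g: cring_hom "mpoly_subst g" by (rule cring_hom_mpoly_subst)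
  assume "D dvd p"
  moreover have "mpoly_subst g D = 0"
    unfolding mpoly_subst_eq_eval eval_D[OF cring_hom_Fract_const]
    using at_parameter(1) by (simp add: lift_frac_def)
  ultimately show "mpoly_subst g p = 0"
    using g.hom_dvd[of D p] by simp
qed (rule dvd_of_subst_g)

lemma subst_g_T: "mpoly_subst g (lower T $ k) = Fract (W $ k) 1 * mpoly_subst g (lower T $ 1)"
proof -
  interpret g: cring_hom "mpoly_subst g" by (rule cring_hom_mpoly_subst)
  have T: "map_vec (mpoly_subst g) (lower T) = lower (twist (lift_frac A) (lift_frac C) g)"
    unfolding g.map_vec_lower
    unfolding mpoly_subst_eq_eval eval_T[OF cring_hom_Fract_const] lift_frac_def ..
  have "mpoly_subst g (lower T $ k) = lower (twist (lift_frac A) (lift_frac C) g) $ k" for k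
    unfolding T[symmetric] by (simp add: map_vec_def)
  then show ?thesis by (simp only: at_parameter(2)[of k])
qed

theorem birationally_equivalent_plane:
  "birationally_equivalent {p. D dvd p} (affine_plane :: (2, 'k) mpoly set)"
  unfolding affine_plane_def
proof (rule birationally_equivalent_affine_space)
  show "mpoly_subst g p = 0 \<longleftrightarrow> D dvd p" for p by (rule subst_g_eq_0_iff)
  show "\<not> D dvd lower T $ 1" by (rule not_dvd_T)
  have "\<forall>j. mpoly_subst g (vector [lower T $ 2, lower T $ 3] $ j) =
      Fract (mpoly_var j :: (2, 'k) mpoly) 1 * mpoly_subst g (lower T $ 1)"
    unfolding forall_2 vector_2 subst_g_T[of 2] subst_g_T[of 3] by (simp add: W_def)
  then show "mpoly_subst g (vector [lower T $ 2, lower T $ 3] $ j) =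
      Fract (mpoly_var j :: (2, 'k) mpoly) 1 * mpoly_subst g (lower T $ 1)" for j ..
qed

end

section \<open>Genericity\<close>

definition offsets :: "'a::comm_ring_1^3^3 \<Rightarrow> 'a^3^6 \<Rightarrow> 'a^3^6 \<Rightarrow> 'a^3^6" where
  "offsets M A b = (\<chi> i. M *v (b $ i) - A $ i)"

lemma (in cring_hom) map_vec_offsets:
  "map_vec (map_vec \<phi>) (offsets M A b) =
    offsets (map_vec (map_vec \<phi>) M) (map_vec (map_vec \<phi>) A) (map_vec (map_vec \<phi>) b)"
  by (simp add: offsets_def map_vec_def matrix_vector_mult_def vec_eq_iff hom_diff hom_sum hom_mult)

lemma (in cring_hom) hom_general_position_offsets:
  "\<phi> (general_position A (offsets M A b)) =
    general_position (map_vec (map_vec \<phi>) A)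
      (offsets (map_vec (map_vec \<phi>) M) (map_vec (map_vec \<phi>) A) (map_vec (map_vec \<phi>) b))"
  by (simp add: hom_general_position map_vec_offsets)

definition general_at :: "real^3^3 \<Rightarrow> architecture \<Rightarrow> real" where
  "general_at M a = general_position (fst a) (offsets M (fst a) (snd a))"

lemma real_polynomial_function_mpoly_eval:
  fixes x :: "'a::real_normed_vector \<Rightarrow> real^'n::finite"
  assumes "\<And>i. real_polynomial_function (\<lambda>a. x a $ i)"
  shows "real_polynomial_function (\<lambda>a. mpoly_eval \<phi> (x a) p)"
  unfolding mpoly_eval_def
  by (intro real_polynomial_function_sum real_polynomial_function.intros(2,4)
      real_polynomial_function_prod real_polynomial_function_power assms finite_keys finite)

text \<open>
  Since \<open>general_position\<close> commutes with ring homomorphisms, it suffices to form it once for the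
  generic architecture, whose entries are 36 variables.
\<close>

lemma real_polynomial_function_general_at: "real_polynomial_function (general_at M)"
proof -
  define x :: "architecture \<Rightarrow> real^((6 \<times> 3) + (6 \<times> 3))" where
    "x a = (\<chi> v. case v of Inl (i, k) \<Rightarrow> fst a $ i $ k | Inr (i, k) \<Rightarrow> snd a $ i $ k)" for a
  define A b :: "((6 \<times> 3 + 6 \<times> 3, real) mpoly)^3^6" where
    "A = (\<chi> i k. mpoly_var (Inl (i, k)))" and "b = (\<chi> i k. mpoly_var (Inr (i, k)))"
  define p where "p = general_position A (offsets (map_vec (map_vec mpoly_const) M) A b)"
  have id: "cring_hom (\<lambda>c::real. c)" by standard simp_all
  have "general_at M a = mpoly_eval (\<lambda>c. c) (x a) p" for a
  proof -
    interpret e: cring_hom "mpoly_eval (\<lambda>c. c) (x a)"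
      by (intro cring_hom_mpoly_eval id)
    show ?thesis
      unfolding p_def e.hom_general_position_offsets general_at_def
      by (simp add: map_vec_def A_def b_def x_def mpoly_eval_var id mpoly_eval_const)
  qed
  moreover have "real_polynomial_function (\<lambda>a. x a $ v)" for v
  proof -
    have "bounded_linear (\<lambda>a::architecture. fst a $ i $ k)"
      and "bounded_linear (\<lambda>a::architecture. snd a $ i $ k)" for i k
      by (intro bounded_linear_compose[OF bounded_linear_vec_nth] bounded_linear_compose[OF bounded_linear_vec_nth]
          bounded_linear_fst bounded_linear_snd)+
    then show ?thesis
      by (cases v) (auto simp: x_def case_prod_unfold)
  qed
  ultimately show ?thesis
    using real_polynomial_function_mpoly_eval[of x "\<lambda>c. c" p] by presburger
qed

section \<open>From the function field to real rotations\<close>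

lemma cring_hom_so3_eval: "cring_hom (\<lambda>f. so3_eval f R)"
  by standard (simp_all add: one_so3_fun.rep_eq plus_so3_fun.rep_eq times_so3_fun.rep_eq)

definition K_anchors :: "architecture \<Rightarrow> so3_field^3^6" where
  "K_anchors a = map_vec (map_vec K_of_real) (fst a)"

definition K_offsets :: "architecture \<Rightarrow> so3_field^3^6" where
  "K_offsets a = (\<chi> i. leg_offset a i)"

text \<open>The expression comes from the coordinate ring, whose elements are functions on real
  rotations, so it is nonzero iff one of its values is. The condition over \<open>K\<close> thus
  becomes a union of real polynomial conditions on the architecture.\<close>

lemma general_position_K:
  "general_position (K_anchors a) (K_offsets a) \<noteq> 0 \<longleftrightarrow> (\<exists>R. general_at (mat_of_so3 R) a \<noteq> 0)"
proof -
  interpret F: cring_hom "\<lambda>x::so3_fun. Fract x 1" by (rule cring_hom_Fract)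
  define SA Sb where "SA = map_vec (map_vec so3_const) (fst a)" and "Sb = map_vec (map_vec so3_const) (snd a)"
  define SR where "SR = (\<chi> i j. so3_entry i j)"
  define p where "p = general_position SA (offsets SR SA Sb)"
  have A: "K_anchors a = map_vec (map_vec (\<lambda>x. Fract x 1)) SA"
    by (simp add: K_anchors_def SA_def map_vec_def K_of_real_def)
  have R: "generic_rotation = map_vec (map_vec (\<lambda>x. Fract x 1)) SR"
    by (simp add: generic_rotation_def SR_def map_vec_def)
  have b: "map_vec K_of_real (snd a $ i) = map_vec (map_vec (\<lambda>x. Fract x 1)) Sb $ i" for i
    by (simp add: Sb_def map_vec_def K_of_real_def)
  have "K_offsets a = offsets generic_rotation (K_anchors a) (map_vec (map_vec (\<lambda>x. Fract x 1)) Sb)"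
    by (simp add: K_offsets_def leg_offset_def case_prod_unfold offsets_def b)
      (simp add: K_anchors_def map_vec_def)
  then have "general_position (K_anchors a) (K_offsets a) = Fract p 1"
    unfolding p_def F.hom_general_position_offsets by (simp add: A R)
  then have "general_position (K_anchors a) (K_offsets a) \<noteq> 0 \<longleftrightarrow> p \<noteq> 0"
    by (simp add: Zero_fract_def eq_fract)
  moreover have "p \<noteq> 0 \<longleftrightarrow> (\<exists>R. so3_eval p R \<noteq> 0)"
    by (auto simp: fun_eq_iff zero_so3_fun.rep_eq simp flip: so3_eval_inject)
  moreover have "so3_eval p R = general_at (mat_of_so3 R) a" for R
  proof -
    interpret e: cring_hom "\<lambda>f. so3_eval f R" by (rule cring_hom_so3_eval)
    show ?thesis
      unfolding p_def e.hom_general_position_offsets general_at_def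
      by (simp add: map_vec_def SA_def Sb_def SR_def so3_const.rep_eq so3_entry.rep_eq)
  qed
  ultimately show ?thesis by simp
qed

section \<open>An explicit platform in general position\<close>

text \<open>This spares the example the expansion of minors: a guessed kernel vector suffices, up to
  an unknown nonzero factor. By \<open>ker\<close>, the row \<open>axis k 1\<close> completes the
  other rows to an invertible matrix, whose determinant is entry \<open>k\<close> of the cofactor
  vector.\<close>

lemma row_cofactor_multiple:
  fixes X :: "'a::field^'n^'n"
  assumes "\<And>i. i \<noteq> r \<Longrightarrow> dot (X $ i) v = 0" and "v $ k \<noteq> 0"
    and ker: "\<And>x. (\<And>i. i \<noteq> r \<Longrightarrow> dot (X $ i) x = 0) \<Longrightarrow> x $ k = 0 \<Longrightarrow> x = 0"
  obtains c where "c \<noteq> 0" "row_cofactor r X = c *s v"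
proof -
  let ?Y = "row_subst r (axis k 1) X"
  have "x = 0" if x: "?Y *v x = 0" for x
  proof (rule ker)
    have Y: "dot (?Y $ i) x = 0" for i
      using arg_cong[OF x, of "\<lambda>v. v $ i"] by (simp add: matrix_vector_mult_def dot_def)
    show "dot (X $ i) x = 0" if "i \<noteq> r" for i
      using Y[of i] that by (simp add: row_subst_def)
    have "dot (axis k 1) x = (\<Sum>i\<in>UNIV. if i = k then x $ i else 0)"
      unfolding dot_def by (rule sum.cong) (auto simp: axis_def)
    then show "x $ k = 0"
      using Y[of r] by (simp add: row_subst_def)
  qed
  then have "det ?Y \<noteq> 0"
    by (metis invertible_det_nz invertible_left_inverse matrix_left_invertible_ker)
  then have "row_cofactor r X $ k \<noteq> 0"
    by (simp add: row_cofactor_def)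
  moreover have "v $ j * row_cofactor r X $ k = v $ k * row_cofactor r X $ j" for j
    by (rule row_cofactor_proportional) (fact assms(1))
  then have "row_cofactor r X = (row_cofactor r X $ k / v $ k) *s v"
    using assms(2) by (simp add: vec_eq_iff field_simps)
  ultimately show ?thesis using that assms(2) by (metis divide_eq_0_iff)
qed

text \<open>Sparse integers for which the line \<open>z *s example_C $ 2\<close> meets the surface
  at z = 0, -1 and 1. Together with z = -2, which enters \<kappa> and \<epsilon>, these are the only
  points where kernel vectors have to be computed.\<close>

definition example_A :: "real^3^6" where
  "example_A = vector [0, vector [0, 1, 0], vector [2, 1, 2], vector [1, 0, 0], 0, vector [- 1, 0, 1]]"

definition example_C :: "real^3^6" where
  "example_C = vector [0, vector [0, 0, 1], vector [0, 0, - 1], vector [0, - 1, 0], vector [1, 0, 0], vector [0, 1, 0]]"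

lemma example_entries:
  "example_A $ 2 $ 1 = 0" "example_A $ 2 $ 2 = 1" "example_A $ 2 $ 3 = 0"
  "example_A $ 3 $ 1 = 2" "example_A $ 3 $ 2 = 1" "example_A $ 3 $ 3 = 2"
  "example_A $ 4 $ 1 = 1" "example_A $ 4 $ 2 = 0" "example_A $ 4 $ 3 = 0"
  "example_A $ 5 = 0"
  "example_A $ 6 $ 1 = - 1" "example_A $ 6 $ 2 = 0" "example_A $ 6 $ 3 = 1"
  "example_C $ 2 $ 1 = 0" "example_C $ 2 $ 2 = 0" "example_C $ 2 $ 3 = 1"
  "example_C $ 3 $ 1 = 0" "example_C $ 3 $ 2 = 0" "example_C $ 3 $ 3 = - 1"
  "example_C $ 4 $ 1 = 0" "example_C $ 4 $ 2 = - 1" "example_C $ 4 $ 3 = 0"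
  "example_C $ 5 $ 1 = 1" "example_C $ 5 $ 2 = 0" "example_C $ 5 $ 3 = 0"
  "example_C $ 6 $ 1 = 0" "example_C $ 6 $ 2 = 1" "example_C $ 6 $ 3 = 0"
  by (simp_all add: example_A_def example_C_def)

lemma example_pole:
  obtains c where "c \<noteq> 0" "pole example_A example_C = c *s vector [- 1, 1, 0]"
proof -
  let ?X = "\<chi> i. join (example_C $ i) (example_A $ i)"
  obtain c where c: "c \<noteq> 0" "row_cofactor 1 ?X = c *s vector [0, - 1, - 1, - 1, 1, 0]"
  proof (rule row_cofactor_multiple[of 1 ?X "vector [0, - 1, - 1, - 1, 1, 0]" 2])
    fix x :: "real^6" assume "\<And>i. i \<noteq> 1 \<Longrightarrow> dot (?X $ i) x = 0" "x $ 2 = 0"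
    then have "(\<forall>i\<in>{2, 3, 4, 5, 6}. dot (?X $ i) x = 0) \<and> x $ 2 = 0" by simp
    then show "x = 0"
      by (simp add: dot_join dot_3 example_entries vec_eq_iff forall_6)
  next
    fix i :: 6 assume "i \<noteq> 1"
    then show "dot (?X $ i) (vector [0, - 1, - 1, - 1, 1, 0]) = 0"
      using exhaust_6[of i] by (auto simp: dot_join dot_3 example_entries)
  qed auto
  then show ?thesis
    using that[of c] by (simp add: pole_def vec_eq_iff forall_3)
qed

lemma example_twist:
  fixes z :: real and v :: "real^6"
  assumes v: "\<And>i. i \<noteq> 1 \<Longrightarrow> dot (leg_matrix example_A example_C (z *s example_C $ 2) $ i) v = 0"
    and "v $ 2 \<noteq> 0" and z: "z \<in> {- 2, - 1, 0, 1}"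
  obtains c where "c \<noteq> 0" "twist example_A example_C (z *s example_C $ 2) = c *s v"
proof -
  let ?X = "leg_matrix example_A example_C (z *s example_C $ 2)"
  obtain c where "c \<noteq> 0" "row_cofactor 1 ?X = c *s v"
  proof (rule row_cofactor_multiple[OF v \<open>v $ 2 \<noteq> 0\<close>])
    fix x :: "real^6" assume "\<And>i. i \<noteq> 1 \<Longrightarrow> dot (?X $ i) x = 0" "x $ 2 = 0"
    then have "(\<forall>i\<in>{2, 3, 4, 5, 6}. dot (?X $ i) x = 0) \<and> x $ 2 = 0" by simp
    then show "x = 0"
      using z by (auto simp: leg_matrix_def dot_join dot_3 example_entries vec_eq_iff forall_6)
  qed
  then show ?thesis using that by (simp add: twist_def)
qed

lemma example_par_den_twist:
  fixes z :: real and v :: "real^6"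
  assumes v: "\<And>i. i \<noteq> 1 \<Longrightarrow> dot (leg_matrix example_A example_C (z *s example_C $ 2) $ i) v = 0"
    and "v $ 2 \<noteq> 0" and z: "z \<in> {- 2, - 1, 0, 1}"
    and "v $ 4 \<noteq> v $ 5" "dot (upper v) (lower v) \<noteq> 0"
  shows "par_den_twist example_A example_C (z *s example_C $ 2) \<noteq> 0"
proof -
  obtain c where c: "c \<noteq> 0" "twist example_A example_C (z *s example_C $ 2) = c *s v"
    using example_twist[OF assms(1-3)] .
  obtain d where d: "d \<noteq> 0" "pole example_A example_C = d *s vector [- 1, 1, 0]"
    using example_pole .
  have "vel_den example_A example_C (lower (c *s v)) = c * d * (v $ 5 - v $ 4)"
    by (simp add: vel_den_eq d(2) dot_3 algebra_simps)
  moreover have "dot (upper (c *s v)) (lower (c *s v)) = c\<^sup>2 * dot (upper v) (lower v)"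
    by (simp add: dot_3 power2_eq_square algebra_simps)
  ultimately show ?thesis
    using assms c d by (simp add: par_den_twist_def)
qed

lemma example_general_position: "general_position example_A example_C \<noteq> 0"
proof -
  let ?P = "\<lambda>z::real. z *s example_C $ 2"
  have leg: "dot (leg_matrix example_A example_C (?P z) $ i) v = 0"
    if "\<forall>i\<in>{2, 3, 4, 5, 6}. dot (leg_matrix example_A example_C (?P z) $ i) v = 0" "i \<noteq> 1" for z v i
    using that exhaust_6[of i] by auto
  note ev = leg_matrix_def dot_join dot_3 example_entries
  obtain c1 where c1: "c1 \<noteq> 0" "twist example_A example_C (?P 1) = c1 *s vector [0, 1, 0, 0, - 1, 0]"
    by (rule example_twist[OF leg, of 1 "vector [0, 1, 0, 0, - 1, 0]"]) (simp_all add: ev)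
  obtain c2 where c2: "c2 \<noteq> 0" "twist example_A example_C (?P (- 2)) = c2 *s vector [0, 11, 6, 6, 4, - 3]"
    by (rule example_twist[OF leg, of "- 2" "vector [0, 11, 6, 6, 4, - 3]"]) (simp_all add: ev)
  obtain c0 where c0: "c0 \<noteq> 0" "twist example_A example_C (?P 0) = c0 *s vector [0, 1, - 2, 2, 0, - 1]"
    by (rule example_twist[OF leg, of 0 "vector [0, 1, - 2, 2, 0, - 1]"]) (simp_all add: ev)
  \<comment> \<open>So z = 1 is the third zero, in accordance with \<kappa> = - \<epsilon> below,
    and the scaled platform in \<open>general_position\<close> reduces to this point.\<close>
  have D1: "platform_det example_A example_C (example_C $ 2) = 0"
    using c1(2) by (simp add: platform_det_def dot_3 example_entries)
  have D2: "platform_det example_A example_C (- 2 *s example_C $ 2) = - 12 * c2"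
    unfolding platform_det_def c2(2) by (simp add: dot_3 example_entries)
  have kappa: "line_kappa example_A example_C = 12 * c2" and eps: "line_eps example_A example_C = - 12 * c2"
    unfolding line_kappa_def line_eps_def D1 D2 by simp_all
  have "par_den_twist example_A example_C (?P 0) \<noteq> 0"
    by (rule example_par_den_twist[OF leg, of 0 "vector [0, 1, - 2, 2, 0, - 1]"]) (simp_all add: ev)
  moreover have "par_den_twist example_A example_C (?P (- 1)) \<noteq> 0"
    by (rule example_par_den_twist[OF leg, of "- 1" "vector [0, 2, 0, 2, 1, - 1]"]) (simp_all add: ev)
  moreover have "par_den_twist example_A example_C (?P 1) \<noteq> 0"
    by (rule example_par_den_twist[OF leg, of 1 "vector [0, 1, 0, 0, - 1, 0]"]) (simp_all add: ev)
  moreover have "par_den_twist example_A (map_vec ((*s) (12 * c2)) example_C) ((12 * c2) *s example_C $ 2) =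
      (12 * c2) ^ 26 * par_den_twist example_A example_C (?P 1)"
    by (simp add: par_den_twist_scale)
  ultimately show ?thesis
    using c0 c2(1) unfolding general_position_def kappa eps by simp
qed

section \<open>The Jacobian of an architecture and the Zariski open set\<close>

lemma det_Jac:
  assumes "a \<in> architectures"
  shows "det (Jac a) = platform_det (map_vec (map_vec mpoly_const) (K_anchors a))
    (map_vec (map_vec mpoly_const) (K_offsets a)) (\<chi> k. mpoly_var k)"
proof -
  let ?A = "map_vec (map_vec mpoly_const) (K_anchors a) :: ((3, so3_field) mpoly)^3^6"
  let ?C = "map_vec (map_vec mpoly_const) (K_offsets a) :: ((3, so3_field) mpoly)^3^6"
  interpret c: cring_hom "mpoly_const :: so3_field \<Rightarrow> (3, so3_field) mpoly"
    by (rule cring_hom_mpoly_const)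
  have K0: "K_of_real 0 = 0"
    by (simp add: K_of_real_def Zero_fract_def so3_const.abs_eq zero_so3_fun.abs_eq)
  have a: "fst a $ 1 = 0" "snd a $ 1 = 0" using assms by (auto simp: architectures_def)
  have A1: "K_anchors a $ 1 = 0" by (simp add: K_anchors_def map_vec_def a K0 vec_eq_iff)
  have C1: "K_offsets a $ 1 = 0"
    by (simp add: K_offsets_def leg_offset_def case_prod_unfold map_vec_def a K0 vec_eq_iff
        matrix_vector_mult_def)
  have leg: "leg a i = ?C $ i + (\<chi> k. mpoly_var k)" for i
    by (simp add: leg_def K_offsets_def map_vec_def)
  have anchor: "map_vec (\<lambda>c. mpoly_const (K_of_real c)) (fst a $ i) = ?A $ i" for i
    by (simp add: K_anchors_def map_vec_def)
  have Jac: "Jac a = (\<chi> i. join (?C $ i + (\<chi> k. mpoly_var k)) (cross (?A $ i) (?C $ i + (\<chi> k. mpoly_var k))))"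
    unfolding Jac_def Let_def leg anchor join_def ..
  have "?A $ 1 = 0" "?C $ 1 = 0"
    by (simp_all add: map_vec_def A1 C1 c.hom_zero vec_eq_iff)
  then show ?thesis
    unfolding Jac by (rule det_legs_eq_platform_det)
qed

theorem corollary9:
  shows "\<exists>U. zariski_open_in architectures U \<and> U \<noteq> {} \<and>
    (\<forall>a\<in>U. birationally_equivalent (Sigma_surface a) (affine_plane :: (2, so3_field) mpoly set))"
proof (intro exI conjI ballI)
  let ?F = "range (\<lambda>R. general_at (mat_of_so3 R))"
  let ?U = "{a \<in> architectures. \<exists>f\<in>?F. f a \<noteq> 0}"
  show "zariski_open_in architectures ?U"
    unfolding zariski_open_in_def
    by (rule exI[of _ ?F]) (auto intro: real_polynomial_function_general_at)
  \<comment> \<open>At the identity rotation the offsets are \<open>b - A\<close>, so this choice of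
    \<open>b\<close> makes them \<open>example_C\<close>.\<close>
  define a where "a = (example_A, example_C + example_A)"
  have "rotation_matrix (mat 1 :: real^3^3)"
    by (simp add: rotation_matrix_def orthogonal_matrix_id)
  then have "mat_of_so3 (so3_of_mat (mat 1)) = mat 1"
    by (simp add: so3_of_mat_inverse)
  then have "general_at (mat_of_so3 (so3_of_mat (mat 1))) a = general_position example_A example_C"
    by (simp add: general_at_def offsets_def a_def)
  then have "general_at (mat_of_so3 (so3_of_mat (mat 1))) a \<noteq> 0"
    using example_general_position by simp
  moreover have "a \<in> architectures"
    by (simp add: a_def architectures_def example_A_def example_C_def)
  ultimately have "a \<in> ?U" by blast
  then show "?U \<noteq> {}" by blast
next
  fix a
  assume "a \<in> {a \<in> architectures. \<exists>f\<in>range (\<lambda>R. general_at (mat_of_so3 R)). f a \<noteq> 0}"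
  then have a: "a \<in> architectures" and "general_position (K_anchors a) (K_offsets a) \<noteq> 0"
    by (auto simp: general_position_K)
  then interpret general_platform "K_anchors a" "K_offsets a" by unfold_locales
  have "Sigma_surface a = {p. D dvd p}"
    by (simp add: Sigma_surface_def det_Jac[OF a] D_def)
  then show "birationally_equivalent (Sigma_surface a) (affine_plane :: (2, so3_field) mpoly set)"
    using birationally_equivalent_plane by simp
qed

end
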